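(* For each positive integer $\nu$ let $\mu(\mathcal M^1_\nu)$ be the expected number of critical points on $S^1=\mathbb R/2\pi\mathbb Z$ of a random trigonometric polynomial in $V(\mathcal M_\nu^1)=\mathrm{span}\{\cos(m\theta),\sin(m\theta):\ 1\le m\le\nu\}$. Then $$\mu(\mathcal M_\nu^1)\sim2\sqrt{\tfrac35}\,\nu\qquad\text{as }\nu\to\infty .$$
   Context: $V(\mathcal M_\nu^1)$ is equipped with the inner product $(u,v)=\int_0^{2\pi}u(\theta)v(\theta)\,d\theta$, and $\mu(\mathcal M_\nu^1)=\frac1{\mathrm{area}(S)}\int_S\mu(v)\,|dS(v)|$, where $S$ is the unit sphere of $V(\mathcal M_\nu^1)$ and $\mu(v)$ is the number of critical points of $v:S^1\to\mathbb R$. $a_\nu\sim b_\nu$ means $a_\nu/b_\nu\to1$. *)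

theory Defs
  imports "HOL-Analysis.Analysis" "HOL-Library.Landau_Symbols"
begin

definition trig_space :: "nat \<Rightarrow> (real \<Rightarrow> real) set" where
  "trig_space \<nu> = {v. \<exists>a b :: nat \<Rightarrow> real.
     v = (\<lambda>\<theta>. \<Sum>m=1..\<nu>. a m * cos (real m * \<theta>) + b m * sin (real m * \<theta>))}"

definition L2_inner :: "(real \<Rightarrow> real) \<Rightarrow> (real \<Rightarrow> real) \<Rightarrow> real" where
  "L2_inner u v = integral {0..2*pi} (\<lambda>\<theta>. u \<theta> * v \<theta>)"

definition L2_norm :: "(real \<Rightarrow> real) \<Rightarrow> real" where
  "L2_norm v = sqrt (L2_inner v v)"

definition L2_dist :: "(real \<Rightarrow> real) \<Rightarrow> (real \<Rightarrow> real) \<Rightarrow> real" where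
  "L2_dist u v = L2_norm (\<lambda>\<theta>. u \<theta> - v \<theta>)"

definition trig_sphere :: "nat \<Rightarrow> (real \<Rightarrow> real) set" where
  "trig_sphere \<nu> = {v \<in> trig_space \<nu>. L2_norm v = 1}"

(* Borel sigma-algebra of the inner product space; the measure it carries is 0 and only its
   measurable sets matter. *)
definition trig_borel :: "nat \<Rightarrow> (real \<Rightarrow> real) measure" where
  "trig_borel \<nu> = sigma (trig_space \<nu>)
     {U. openin (Metric_space.mtopology (trig_space \<nu>) L2_dist) U}"

(* The orthonormal basis cos (m \<theta>) / sqrt pi (indices k = m - 1 < \<nu>) and
   sin (m \<theta>) / sqrt pi (indices k = \<nu> + m - 1) of the 2 \<nu>-dimensional space. *)
definition trig_basis :: "nat \<Rightarrow> nat \<Rightarrow> real \<Rightarrow> real" where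
  "trig_basis \<nu> k \<theta> = (if k < \<nu> then cos (real (k + 1) * \<theta>) else sin (real (k - \<nu> + 1) * \<theta>)) / sqrt pi"

definition trig_comb :: "nat \<Rightarrow> (nat \<Rightarrow> real) \<Rightarrow> real \<Rightarrow> real" where
  "trig_comb \<nu> x = (\<lambda>\<theta>. \<Sum>k<2*\<nu>. x k * trig_basis \<nu> k \<theta>)"

(* Euclidean volume of the inner product space: Lebesgue measure of R^(2 \<nu>) transported along
   the coordinate isometry. *)
definition trig_volume :: "nat \<Rightarrow> (real \<Rightarrow> real) measure" where
  "trig_volume \<nu> = distr (Pi\<^sub>M {..<2*\<nu>} (\<lambda>_. lborel)) (trig_borel \<nu>) (trig_comb \<nu>)"

(* Area on the unit sphere, determined by polar coordinates dv = r^(N-1) dr |dS|, N = 2 \<nu>: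
   area A = N * vol {v. 0 < |v| \<le> 1 \<and> v / |v| \<in> A}; see lemma emeasure_sphere_area. *)
definition sphere_area :: "nat \<Rightarrow> (real \<Rightarrow> real) measure" where
  "sphere_area \<nu> = scale_measure (ennreal (real (2 * \<nu>)))
     (distr (restrict_space (trig_volume \<nu>) {v. 0 < L2_norm v \<and> L2_norm v \<le> 1})
        (restrict_space (trig_borel \<nu>) (trig_sphere \<nu>))
        (\<lambda>v \<theta>. v \<theta> / L2_norm v))"

(* The circle R / 2 pi Z is represented by its fundamental domain [0, 2 pi). *)
definition critical_points :: "(real \<Rightarrow> real) \<Rightarrow> real set" where
  "critical_points v = {\<theta> \<in> {0..<2*pi}. (v has_real_derivative 0) (at \<theta>)}"

definition mean_crit :: "nat \<Rightarrow> real" where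
  "mean_crit \<nu> = 1 / measure (sphere_area \<nu>) (trig_sphere \<nu>) *
     (\<integral>v. real (card (critical_points v)) \<partial>sphere_area \<nu>)"


lemma integral_cos_period:
  "((\<lambda>x. cos (of_int n * x)) has_integral (if n = 0 then 2 * pi else 0)) {0..2*pi}"
proof (cases "n = 0")
  case True
  then show ?thesis
    using has_integral_const_real [of "1::real" 0 "2*pi"] by auto
next
  case False
  have "((\<lambda>x. cos (n * x)) has_integral (sin (n * (2*pi))/n - sin (of_int n * 0)/n)) {0..2*pi}"
  proof (rule fundamental_theorem_of_calculus)
    show "((\<lambda>x. sin (n * x) / n) has_vector_derivative cos (n * x)) (at x within {0..2*pi})"
      for x :: real
      using False unfolding has_vector_derivative_def
      by (intro derivative_eq_intros | force)+
  qed auto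
  moreover have "sin (of_int n * (2*pi)) = 0"
    using sin_integer_2pi[of "of_int n"] by (simp add: mult_ac)
  ultimately show ?thesis using False by simp
qed

lemma integral_sin_period:
  "((\<lambda>x. sin (of_int n * x)) has_integral 0) {0..2*pi}"
proof (cases "n = 0")
  case False
  have "((\<lambda>x. sin (n * x)) has_integral (- cos (n * (2*pi))/n - - cos (of_int n * 0)/n)) {0..2*pi}"
  proof (rule fundamental_theorem_of_calculus)
    show "((\<lambda>x. - cos (n * x) / n) has_vector_derivative sin (n * x)) (at x within {0..2*pi})"
      for x :: real
      using False unfolding has_vector_derivative_def
      by (intro derivative_eq_intros | force)+
  qed auto
  moreover have "cos (of_int n * (2*pi)) = 1"
    using cos_integer_2pi[of "of_int n"] by (simp add: mult_ac)
  ultimately show ?thesis using False by simp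
qed auto

lemma trig_basis_orthonormal:
  assumes "j < 2 * \<nu>" "k < 2 * \<nu>"
  shows "((\<lambda>\<theta>. trig_basis \<nu> j \<theta> * trig_basis \<nu> k \<theta>) has_integral (if j = k then 1 else 0)) {0..2*pi}"
proof -
  have pp: "sqrt pi * sqrt pi = pi" by simp
  have cc: "((\<lambda>\<theta>. cos (real (Suc a) * \<theta>) / sqrt pi * (cos (real (Suc b) * \<theta>) / sqrt pi))
      has_integral (if a = b then 1 else 0)) {0..2*pi}" for a b
  proof -
    have "((\<lambda>x. (cos (of_int (int a - int b) * x) + cos (of_int (int a + int b + 2) * x)) * (1 / (2*pi)))
       has_integral ((if int a - int b = 0 then 2 * pi else 0) + (if int a + int b + 2 = 0 then 2 * pi else 0)) * (1 / (2*pi))) {0..2*pi}"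
      by (intro has_integral_mult_left has_integral_add integral_cos_period)
    moreover have "(cos (of_int (int a - int b) * x) + cos (of_int (int a + int b + 2) * x)) * (1 / (2*pi))
      = cos (real (Suc a) * x) / sqrt pi * (cos (real (Suc b) * x) / sqrt pi)" for x
      using cos_times_cos[of "real (Suc a) * x" "real (Suc b) * x"] pp
      by (simp add: field_simps)
    ultimately show ?thesis by (simp split: if_splits)
  qed
  have ss: "((\<lambda>\<theta>. sin (real (Suc a) * \<theta>) / sqrt pi * (sin (real (Suc b) * \<theta>) / sqrt pi))
      has_integral (if a = b then 1 else 0)) {0..2*pi}" for a b
  proof -
    have "((\<lambda>x. (cos (of_int (int a - int b) * x) - cos (of_int (int a + int b + 2) * x)) * (1 / (2*pi)))
       has_integral ((if int a - int b = 0 then 2 * pi else 0) - (if int a + int b + 2 = 0 then 2 * pi else 0)) * (1 / (2*pi))) {0..2*pi}"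
      by (intro has_integral_mult_left has_integral_diff integral_cos_period)
    moreover have "(cos (of_int (int a - int b) * x) - cos (of_int (int a + int b + 2) * x)) * (1 / (2*pi))
      = sin (real (Suc a) * x) / sqrt pi * (sin (real (Suc b) * x) / sqrt pi)" for x
    proof -
      have "real_of_int (int a - int b) * x = real (Suc a) * x - real (Suc b) * x"
        "real_of_int (int a + int b + 2) * x = real (Suc a) * x + real (Suc b) * x"
        by (simp_all add: algebra_simps)
      then have "(cos (of_int (int a - int b) * x) - cos (of_int (int a + int b + 2) * x)) / 2
        = sin (real (Suc a) * x) * sin (real (Suc b) * x)"
        by (simp only: sin_times_sin)
      then show ?thesis using pp by (simp only: times_divide_times_eq) simp
    qed
    ultimately show ?thesis by (simp split: if_splits)
  qed
  have sc: "((\<lambda>\<theta>. sin (real (Suc a) * \<theta>) / sqrt pi * (cos (real (Suc b) * \<theta>) / sqrt pi))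
      has_integral 0) {0..2*pi}" for a b
  proof -
    have "((\<lambda>x. (sin (of_int (int a + int b + 2) * x) + sin (of_int (int a - int b) * x)) * (1 / (2*pi)))
       has_integral (0 + 0) * (1 / (2*pi))) {0..2*pi}"
      by (intro has_integral_mult_left has_integral_add integral_sin_period)
    moreover have "(sin (of_int (int a + int b + 2) * x) + sin (of_int (int a - int b) * x)) * (1 / (2*pi))
      = sin (real (Suc a) * x) / sqrt pi * (cos (real (Suc b) * x) / sqrt pi)" for x
      using sin_times_cos[of "real (Suc a) * x" "real (Suc b) * x"] pp
      by (simp add: field_simps)
    ultimately show ?thesis by simp
  qed
  have cs: "((\<lambda>\<theta>. cos (real (Suc a) * \<theta>) / sqrt pi * (sin (real (Suc b) * \<theta>) / sqrt pi))
      has_integral 0) {0..2*pi}" for a b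
    using sc[of b a] by (simp add: mult.commute)
  show ?thesis
  proof (cases "j < \<nu>"; cases "k < \<nu>")
    assume "j < \<nu>" "k < \<nu>"
    then show ?thesis using cc[of j k] by (simp add: trig_basis_def)
  next
    assume "j < \<nu>" "\<not> k < \<nu>"
    then show ?thesis using cs[of j "k - \<nu>"] by (auto simp: trig_basis_def)
  next
    assume "\<not> j < \<nu>" "k < \<nu>"
    then show ?thesis using sc[of "j - \<nu>" k] by (auto simp: trig_basis_def)
  next
    assume "\<not> j < \<nu>" "\<not> k < \<nu>"
    moreover from this have "j - \<nu> = k - \<nu> \<longleftrightarrow> j = k" by auto
    ultimately show ?thesis using ss[of "j - \<nu>" "k - \<nu>"] by (simp add: trig_basis_def)
  qed
qed

lemma L2_inner_trig_comb:
  "L2_inner (trig_comb \<nu> x) (trig_comb \<nu> y) = (\<Sum>k<2*\<nu>. x k * y k)"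
proof -
  have "((\<lambda>\<theta>. \<Sum>j<2*\<nu>. \<Sum>k<2*\<nu>. (x j * y k) * (trig_basis \<nu> j \<theta> * trig_basis \<nu> k \<theta>)) has_integral
      (\<Sum>j<2*\<nu>. \<Sum>k<2*\<nu>. (x j * y k) * (if j = k then 1 else 0))) {0..2*pi}"
    by (intro has_integral_sum has_integral_mult_right trig_basis_orthonormal) auto
  moreover have "(\<Sum>j<2*\<nu>. \<Sum>k<2*\<nu>. (x j * y k) * (if j = k then 1 else 0)) = (\<Sum>k<2*\<nu>. x k * y k)"
    by (simp add: sum.delta if_distrib cong: if_cong)
  moreover have "(\<Sum>j<2*\<nu>. \<Sum>k<2*\<nu>. (x j * y k) * (trig_basis \<nu> j \<theta> * trig_basis \<nu> k \<theta>))
      = trig_comb \<nu> x \<theta> * trig_comb \<nu> y \<theta>" for \<theta>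
    unfolding trig_comb_def sum_product by (simp add: mult_ac)
  ultimately show ?thesis
    unfolding L2_inner_def by (simp add: integral_unique)
qed

lemma L2_set_zero: "L2_set (\<lambda>_. 0) A = 0"
  by (simp add: L2_set_def)

lemma L2_norm_trig_comb: "L2_norm (trig_comb \<nu> x) = L2_set x {..<2*\<nu>}"
  by (simp add: L2_norm_def L2_inner_trig_comb L2_set_def power2_eq_square)

lemma trig_comb_diff:
  "(\<lambda>\<theta>. trig_comb \<nu> x \<theta> - trig_comb \<nu> y \<theta>) = trig_comb \<nu> (\<lambda>k. x k - y k)"
  by (auto simp: trig_comb_def left_diff_distrib sum_subtractf)

lemma trig_comb_divide: "(\<lambda>\<theta>. trig_comb \<nu> x \<theta> / c) = trig_comb \<nu> (\<lambda>k. x k / c)"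
  by (auto simp: trig_comb_def sum_divide_distrib)

lemma L2_dist_trig_comb:
  "L2_dist (trig_comb \<nu> x) (trig_comb \<nu> y) = L2_set (\<lambda>k. x k - y k) {..<2*\<nu>}"
  by (simp add: L2_dist_def trig_comb_diff L2_norm_trig_comb)

lemma sum_split_double:
  fixes f :: "nat \<Rightarrow> real"
  shows "(\<Sum>k<2*\<nu>. f k) = (\<Sum>m=1..\<nu>. f (m - 1) + f (\<nu> + m - 1))"
proof -
  have "(\<Sum>k<\<nu>+n. f k) = (\<Sum>k<\<nu>. f k) + (\<Sum>k<n. f (\<nu> + k))" for n
    by (induction n) auto
  moreover have "(\<Sum>m=1..\<nu>. f (m - 1) + f (\<nu> + m - 1)) = (\<Sum>k<\<nu>. f k + f (\<nu> + k))"
    by (rule sum.reindex_bij_witness[of _ Suc "\<lambda>m. m - 1"]) auto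
  ultimately show ?thesis by (simp add: sum.distrib mult_2)
qed

lemma trig_space_eq_range: "trig_space \<nu> = range (trig_comb \<nu>)"
proof safe
  fix x
  have "trig_comb \<nu> x = (\<lambda>\<theta>. \<Sum>m=1..\<nu>. x (m - 1) / sqrt pi * cos (real m * \<theta>)
        + x (\<nu> + m - 1) / sqrt pi * sin (real m * \<theta>))"
    unfolding trig_comb_def sum_split_double
    by (intro ext sum.cong) (auto simp: trig_basis_def of_nat_diff algebra_simps)
  then show "trig_comb \<nu> x \<in> trig_space \<nu>"
    unfolding trig_space_def
    by (intro CollectI exI[of _ "\<lambda>m. x (m - 1) / sqrt pi"] exI[of _ "\<lambda>m. x (\<nu> + m - 1) / sqrt pi"])
next
  fix v assume "v \<in> trig_space \<nu>"
  then obtain a b where v: "v = (\<lambda>\<theta>. \<Sum>m=1..\<nu>. a m * cos (real m * \<theta>) + b m * sin (real m * \<theta>))"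
    unfolding trig_space_def by blast
  have "v = trig_comb \<nu> (\<lambda>k. sqrt pi * (if k < \<nu> then a (k + 1) else b (k - \<nu> + 1)))"
    unfolding v trig_comb_def sum_split_double
    by (intro ext sum.cong) (auto simp: trig_basis_def of_nat_diff)
  then show "v \<in> range (trig_comb \<nu>)" by blast
qed

lemma trig_comb_in: "trig_comb \<nu> x \<in> trig_space \<nu>"
  by (simp add: trig_space_eq_range)

lemma Metric_space_trig_space: "Metric_space (trig_space \<nu>) L2_dist"
proof
  show "0 \<le> L2_dist u v" for u v
    unfolding L2_dist_def L2_norm_def L2_inner_def
    by (cases "(\<lambda>\<theta>. (u \<theta> - v \<theta>) * (u \<theta> - v \<theta>)) integrable_on {0..2*pi}")
       (auto intro!: integral_nonneg simp: not_integrable_integral)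
  show "L2_dist u v = L2_dist v u" for u v
    unfolding L2_dist_def L2_norm_def L2_inner_def by (simp add: algebra_simps)
  show "L2_dist u v = 0 \<longleftrightarrow> u = v" if uv: "u \<in> trig_space \<nu>" "v \<in> trig_space \<nu>" for u v
  proof -
    obtain x y where [simp]: "u = trig_comb \<nu> x" "v = trig_comb \<nu> y"
      using uv by (auto simp: trig_space_eq_range)
    have "u = v" if "\<forall>k<2*\<nu>. x k = y k" using that by (simp add: trig_comb_def)
    moreover have "L2_dist u v = 0" if "u = v"
      using that L2_dist_trig_comb[of \<nu> y y] by (simp add: L2_set_zero)
    ultimately show ?thesis
      using L2_dist_trig_comb[of \<nu> x y] by (auto simp: L2_set_eq_0_iff)
  qed
  show "L2_dist u w \<le> L2_dist u v + L2_dist v w"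
    if "u \<in> trig_space \<nu>" "v \<in> trig_space \<nu>" "w \<in> trig_space \<nu>" for u v w
  proof -
    obtain x y z where uvw: "u = trig_comb \<nu> x" "v = trig_comb \<nu> y" "w = trig_comb \<nu> z"
      using \<open>u \<in> _\<close> \<open>v \<in> _\<close> \<open>w \<in> _\<close> unfolding trig_space_eq_range by (elim imageE)
    have "L2_set (\<lambda>k. (x k - y k) + (y k - z k)) {..<2*\<nu>}
      \<le> L2_set (\<lambda>k. x k - y k) {..<2*\<nu>} + L2_set (\<lambda>k. y k - z k) {..<2*\<nu>}"
      by (rule L2_set_triangle_ineq)
    then show ?thesis by (simp add: uvw L2_dist_trig_comb)
  qed
qed

lemma space_trig_borel [simp]: "space (trig_borel \<nu>) = trig_space \<nu>"
  unfolding trig_borel_def by (rule space_measure_of_conv)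

lemma openin_trig_iff:
  "openin (Metric_space.mtopology (trig_space \<nu>) L2_dist) U \<longleftrightarrow>
    U \<subseteq> trig_space \<nu> \<and> (\<forall>u\<in>U. \<exists>r>0. \<forall>v\<in>trig_space \<nu>. L2_dist u v < r \<longrightarrow> v \<in> U)"
proof -
  interpret Metric_space "trig_space \<nu>" L2_dist by (rule Metric_space_trig_space)
  have "mball u r \<subseteq> U \<longleftrightarrow> (\<forall>v\<in>trig_space \<nu>. L2_dist u v < r \<longrightarrow> v \<in> U)"
    if "u \<in> trig_space \<nu>" for u r
    using that by (auto simp: subset_iff)
  then show ?thesis
    unfolding openin_mtopology by (metis subsetD)
qed

lemma sets_trig_borel:
  "sets (trig_borel \<nu>) = sigma_sets (trig_space \<nu>)
     {U. openin (Metric_space.mtopology (trig_space \<nu>) L2_dist) U}"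
  unfolding trig_borel_def by (rule sets_measure_of) (auto simp: openin_trig_iff)

lemma sets_trig_borel_open:
  assumes "U \<subseteq> trig_space \<nu>"
    and "\<And>u. u \<in> U \<Longrightarrow> \<exists>r>0. \<forall>v\<in>trig_space \<nu>. L2_dist u v < r \<longrightarrow> v \<in> U"
  shows "U \<in> sets (trig_borel \<nu>)"
  using assms unfolding sets_trig_borel by (intro sigma_sets.Basic) (auto simp: openin_trig_iff)

lemma measurable_trig_comb:
  "trig_comb \<nu> \<in> measurable (Pi\<^sub>M {..<2*\<nu>} (\<lambda>_. lborel)) (trig_borel \<nu>)"
proof -
  define ext where "ext = (\<lambda>(x :: nat \<Rightarrow> real) k. if k < 2*\<nu> then x k else 0)"
  have "ext \<in> measurable (Pi\<^sub>M {..<2*\<nu>} (\<lambda>_. lborel)) (Pi\<^sub>M UNIV (\<lambda>_. borel))"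
  proof (rule measurable_PiM_single')
    show "(\<lambda>x. ext x k) \<in> borel_measurable (Pi\<^sub>M {..<2*\<nu>} (\<lambda>_. lborel))" for k
      by (cases "k < 2*\<nu>") (auto simp: ext_def intro: measurable_compose[OF measurable_component_singleton])
  qed auto
  then have ext: "ext \<in> measurable (Pi\<^sub>M {..<2*\<nu>} (\<lambda>_. lborel)) borel"
    using measurable_cong_sets[OF refl sets_PiM_equal_borel] by blast
  have "trig_comb \<nu> \<in> measurable borel (trig_borel \<nu>)"
    unfolding trig_borel_def
  proof (rule measurable_measure_of)
    fix U assume "U \<in> {U. openin (Metric_space.mtopology (trig_space \<nu>) L2_dist) U}"
    then have U: "\<exists>r>0. \<forall>v\<in>trig_space \<nu>. L2_dist u v < r \<longrightarrow> v \<in> U" if "u \<in> U" for u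
      using that by (auto simp: openin_trig_iff)
    have "open (trig_comb \<nu> -` U)"
    proof (subst open_subopen, safe)
      fix x assume "trig_comb \<nu> x \<in> U"
      from U[OF this] obtain r where r: "r > 0"
        "\<And>y. L2_dist (trig_comb \<nu> x) (trig_comb \<nu> y) < r \<Longrightarrow> trig_comb \<nu> y \<in> U"
        using trig_comb_in by blast
      have "continuous_on UNIV (\<lambda>y. L2_set (\<lambda>k. x k - y k) {..<2*\<nu>})"
        unfolding L2_set_def by (intro continuous_intros continuous_on_product_coordinates)
      then have "open {y. L2_set (\<lambda>k. x k - y k) {..<2*\<nu>} < r}"
        by (intro open_Collect_less) auto
      then show "\<exists>T. open T \<and> x \<in> T \<and> T \<subseteq> trig_comb \<nu> -` U"
        using r by (intro exI[of _ "{y. L2_set (\<lambda>k. x k - y k) {..<2*\<nu>} < r}"])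
          (auto simp: L2_dist_trig_comb L2_set_zero)
    qed
    then show "trig_comb \<nu> -` U \<inter> space borel \<in> sets borel" by simp
  qed (auto simp: openin_trig_iff trig_comb_in)
  from measurable_comp[OF ext this] have "trig_comb \<nu> \<circ> ext \<in> measurable (Pi\<^sub>M {..<2*\<nu>} (\<lambda>_. lborel)) (trig_borel \<nu>)" .
  also have "trig_comb \<nu> \<circ> ext = trig_comb \<nu>"
    by (auto simp: ext_def trig_comb_def fun_eq_iff intro!: sum.cong)
  finally show ?thesis .
qed

lemma L2_norm_diff_le:
  assumes "u \<in> trig_space \<nu>" "v \<in> trig_space \<nu>"
  shows "\<bar>L2_norm u - L2_norm v\<bar> \<le> L2_dist u v"
proof -
  obtain x y where [simp]: "u = trig_comb \<nu> x" "v = trig_comb \<nu> y"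
    using assms by (auto simp: trig_space_eq_range)
  have "L2_set (\<lambda>k. (x k - y k) + y k) {..<2*\<nu>} \<le> L2_set (\<lambda>k. x k - y k) {..<2*\<nu>} + L2_set y {..<2*\<nu>}"
    "L2_set (\<lambda>k. (y k - x k) + x k) {..<2*\<nu>} \<le> L2_set (\<lambda>k. y k - x k) {..<2*\<nu>} + L2_set x {..<2*\<nu>}"
    by (rule L2_set_triangle_ineq)+
  moreover have "L2_set (\<lambda>k. y k - x k) {..<2*\<nu>} = L2_set (\<lambda>k. x k - y k) {..<2*\<nu>}"
    by (simp add: L2_set_def power2_commute)
  ultimately show ?thesis by (simp add: L2_dist_trig_comb L2_norm_trig_comb)
qed

lemma measurable_L2_norm: "L2_norm \<in> borel_measurable (trig_borel \<nu>)"
proof (rule borel_measurableI)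
  fix S :: "real set" assume S: "open S"
  show "L2_norm -` S \<inter> space (trig_borel \<nu>) \<in> sets (trig_borel \<nu>)"
  proof (rule sets_trig_borel_open)
    fix u assume u: "u \<in> L2_norm -` S \<inter> space (trig_borel \<nu>)"
    then obtain r where "r > 0" "\<And>t. \<bar>t - L2_norm u\<bar> < r \<Longrightarrow> t \<in> S"
      using S by (auto simp: open_real)
    then show "\<exists>r>0. \<forall>v\<in>trig_space \<nu>. L2_dist u v < r \<longrightarrow> v \<in> L2_norm -` S \<inter> space (trig_borel \<nu>)"
      using L2_norm_diff_le[of u \<nu>] u
      by (intro exI[of _ r]) (force simp: abs_minus_commute)
  qed auto
qed

abbreviation punctured_ball :: "(real \<Rightarrow> real) set" where
  "punctured_ball \<equiv> {v. 0 < L2_norm v \<and> L2_norm v \<le> 1}"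

lemma sets_punctured_ball: "punctured_ball \<inter> trig_space \<nu> \<in> sets (trig_borel \<nu>)"
proof -
  have "L2_norm -` {0<..1} \<inter> space (trig_borel \<nu>) \<in> sets (trig_borel \<nu>)"
    by (rule measurable_sets[OF measurable_L2_norm]) auto
  moreover have "L2_norm -` {0<..1} \<inter> space (trig_borel \<nu>) = punctured_ball \<inter> trig_space \<nu>" by auto
  ultimately show ?thesis by simp
qed

lemma L2_set_divide: "c > 0 \<Longrightarrow> L2_set (\<lambda>k. f k / c) A = L2_set f A / c"
  using L2_set_left_distrib[of "1/c" f A] by simp

lemma normalize_in_sphere:
  assumes "v \<in> trig_space \<nu>" "0 < L2_norm v"
  shows "(\<lambda>\<theta>. v \<theta> / L2_norm v) \<in> trig_sphere \<nu>"
proof -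
  obtain x where [simp]: "v = trig_comb \<nu> x"
    using assms by (auto simp: trig_space_eq_range)
  show ?thesis
    using assms unfolding trig_sphere_def
    by (simp add: trig_comb_divide trig_comb_in L2_norm_trig_comb L2_set_divide)
qed

lemma normalize_dist:
  assumes "u \<in> trig_space \<nu>" "v \<in> trig_space \<nu>" "0 < L2_norm u" "0 < L2_norm v"
  shows "L2_dist (\<lambda>\<theta>. u \<theta> / L2_norm u) (\<lambda>\<theta>. v \<theta> / L2_norm v) \<le> 2 * L2_dist u v / L2_norm u"
proof -
  obtain x y where [simp]: "u = trig_comb \<nu> x" "v = trig_comb \<nu> y"
    using assms by (auto simp: trig_space_eq_range)
  define a b where "a = L2_norm u" and "b = L2_norm v"
  have ab: "a > 0" "b > 0" using assms by (auto simp: a_def b_def)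
  have e: "x k / a - y k / b = (x k - y k) / a + (b - a) / a * (y k / b)" for k
    using ab by (simp add: field_simps)
  have yb: "L2_set (\<lambda>k. (b - a) / a * (y k / b)) {..<2*\<nu>} = \<bar>b - a\<bar> / a"
  proof -
    have "L2_set (\<lambda>k. (b - a) / a * (y k / b)) {..<2*\<nu>} = L2_set (\<lambda>k. \<bar>b - a\<bar> / a * (y k / b)) {..<2*\<nu>}"
      by (simp add: L2_set_def power_mult_distrib power_divide)
    also have "\<dots> = \<bar>b - a\<bar> / a * L2_set (\<lambda>k. y k / b) {..<2*\<nu>}"
      using ab by (intro L2_set_right_distrib[symmetric]) auto
    also have "L2_set (\<lambda>k. y k / b) {..<2*\<nu>} = 1"
      using ab by (simp add: L2_set_divide) (simp add: b_def L2_norm_trig_comb)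
    finally show ?thesis by simp
  qed
  have "L2_set (\<lambda>k. x k / a - y k / b) {..<2*\<nu>}
     \<le> L2_set (\<lambda>k. (x k - y k) / a) {..<2*\<nu>} + L2_set (\<lambda>k. (b - a) / a * (y k / b)) {..<2*\<nu>}"
    unfolding e by (rule L2_set_triangle_ineq)
  also have "\<dots> = L2_dist u v / a + \<bar>b - a\<bar> / a"
    using ab by (simp only: yb) (simp add: L2_set_divide L2_dist_trig_comb)
  also have "\<dots> \<le> L2_dist u v / a + L2_dist u v / a"
    using ab L2_norm_diff_le[OF assms(1,2)]
    by (intro add_left_mono divide_right_mono) (auto simp: a_def b_def abs_minus_commute)
  finally show ?thesis
    unfolding a_def[symmetric] b_def[symmetric] by (simp add: trig_comb_divide L2_dist_trig_comb)
qed

lemma measurable_normalize: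
  "(\<lambda>v \<theta>. v \<theta> / L2_norm v) \<in> measurable (restrict_space (trig_volume \<nu>) punctured_ball)
     (restrict_space (trig_borel \<nu>) (trig_sphere \<nu>))"
proof -
  let ?N = "\<lambda>v \<theta>. v \<theta> / L2_norm v"
  have "?N \<in> measurable (restrict_space (trig_borel \<nu>) punctured_ball) (trig_borel \<nu>)"
    unfolding trig_borel_def[of \<nu>, THEN arg_cong[where f = "\<lambda>M. measurable (restrict_space (trig_borel \<nu>) punctured_ball) M"]]
  proof (rule measurable_measure_of)
    fix U assume "U \<in> {U. openin (Metric_space.mtopology (trig_space \<nu>) L2_dist) U}"
    then have U: "\<exists>r>0. \<forall>v\<in>trig_space \<nu>. L2_dist u v < r \<longrightarrow> v \<in> U" if "u \<in> U" for u
      using that by (auto simp: openin_trig_iff)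
    define W where "W = {v \<in> trig_space \<nu>. 0 < L2_norm v \<and> ?N v \<in> U}"
    have "W \<in> sets (trig_borel \<nu>)"
    proof (rule sets_trig_borel_open)
      fix u assume u: "u \<in> W"
      then obtain r where r: "r > 0" "\<And>v. v \<in> trig_space \<nu> \<Longrightarrow> L2_dist (?N u) v < r \<Longrightarrow> v \<in> U"
        using U unfolding W_def by blast
      have u': "u \<in> trig_space \<nu>" "0 < L2_norm u" using u by (auto simp: W_def)
      show "\<exists>r>0. \<forall>v\<in>trig_space \<nu>. L2_dist u v < r \<longrightarrow> v \<in> W"
      proof (intro exI[of _ "min (L2_norm u) (r * L2_norm u / 2)"] conjI ballI impI)
        show "0 < min (L2_norm u) (r * L2_norm u / 2)" using r u' by auto
        fix v assume v: "v \<in> trig_space \<nu>" "L2_dist u v < min (L2_norm u) (r * L2_norm u / 2)"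
        have pos: "0 < L2_norm v" using L2_norm_diff_le[OF u'(1) v(1)] v(2) by auto
        have "L2_dist (?N u) (?N v) \<le> 2 * L2_dist u v / L2_norm u"
          by (rule normalize_dist[OF u'(1) v(1) u'(2) pos])
        also have "\<dots> < r" using v(2) u' by (simp add: field_simps)
        finally have "?N v \<in> U"
          using normalize_in_sphere[OF v(1) pos] by (intro r) (auto simp: trig_sphere_def)
        then show "v \<in> W" using v pos by (simp add: W_def)
      qed
    qed (auto simp: W_def)
    moreover have "?N -` U \<inter> space (restrict_space (trig_borel \<nu>) punctured_ball) = punctured_ball \<inter> W"
      by (auto simp: W_def space_restrict_space)
    ultimately show "?N -` U \<inter> space (restrict_space (trig_borel \<nu>) punctured_ball)
        \<in> sets (restrict_space (trig_borel \<nu>) punctured_ball)"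
      by (auto simp: sets_restrict_space)
  qed (use normalize_in_sphere in \<open>auto simp: openin_trig_iff space_restrict_space trig_sphere_def\<close>)
  then have "?N \<in> measurable (restrict_space (trig_borel \<nu>) punctured_ball)
      (restrict_space (trig_borel \<nu>) (trig_sphere \<nu>))"
    by (rule measurable_restrict_space2[rotated]) (use normalize_in_sphere in \<open>auto simp: space_restrict_space\<close>)
  moreover have "sets (restrict_space (trig_volume \<nu>) punctured_ball)
      = sets (restrict_space (trig_borel \<nu>) punctured_ball)"
    by (simp add: sets_restrict_space trig_volume_def)
  ultimately show ?thesis by (simp cong: measurable_cong_sets)
qed

lemma trig_sphere_sets: "trig_sphere \<nu> \<in> sets (trig_borel \<nu>)"
proof -
  have "L2_norm -` {1} \<inter> space (trig_borel \<nu>) \<in> sets (trig_borel \<nu>)"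
    by (rule measurable_sets[OF measurable_L2_norm]) auto
  moreover have "L2_norm -` {1} \<inter> space (trig_borel \<nu>) = trig_sphere \<nu>" by (auto simp: trig_sphere_def)
  ultimately show ?thesis by simp
qed

lemma space_sphere_area [simp]: "space (sphere_area \<nu>) = trig_sphere \<nu>"
  by (auto simp: sphere_area_def space_scale_measure space_restrict_space trig_sphere_def)

lemma sets_sphere_area: "sets (sphere_area \<nu>) = {A \<in> sets (trig_borel \<nu>). A \<subseteq> trig_sphere \<nu>}"
  using trig_sphere_sets[of \<nu>] by (auto simp: sphere_area_def sets_restrict_space)

lemma emeasure_sphere_area:
  assumes A: "A \<in> sets (trig_borel \<nu>)" "A \<subseteq> trig_sphere \<nu>"
  shows "emeasure (sphere_area \<nu>) A = ennreal (real (2 * \<nu>)) *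
    emeasure (trig_volume \<nu>)
      {v \<in> trig_space \<nu>. 0 < L2_norm v \<and> L2_norm v \<le> 1 \<and> (\<lambda>\<theta>. v \<theta> / L2_norm v) \<in> A}"
proof -
  have "A \<in> sets (restrict_space (trig_borel \<nu>) (trig_sphere \<nu>))"
    using A by (auto simp: sets_restrict_space)
  moreover have "(\<lambda>v \<theta>. v \<theta> / L2_norm v) -` A \<inter> space (restrict_space (trig_volume \<nu>) punctured_ball)
    = {v \<in> trig_space \<nu>. 0 < L2_norm v \<and> L2_norm v \<le> 1 \<and> (\<lambda>\<theta>. v \<theta> / L2_norm v) \<in> A}"
    by (auto simp: space_restrict_space trig_volume_def)
  moreover have "punctured_ball \<inter> space (trig_volume \<nu>) \<in> sets (trig_volume \<nu>)"
    using sets_punctured_ball[of \<nu>] by (simp add: trig_volume_def)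
  ultimately show ?thesis
    unfolding sphere_area_def
    by (simp add: emeasure_distr[OF measurable_normalize] emeasure_restrict_space subset_iff)
qed

lemma sphere_area_positive_finite:
  assumes "\<nu> > 0"
  shows "0 < emeasure (sphere_area \<nu>) (trig_sphere \<nu>)" "emeasure (sphere_area \<nu>) (trig_sphere \<nu>) < \<infinity>"
proof -
  define n where "n = 2 * \<nu>"
  interpret product_sigma_finite "\<lambda>_::nat. lborel :: real measure" by standard
  define P where "P = Pi\<^sub>M {..<n} (\<lambda>_. lborel :: real measure)"
  let ?D = "{v \<in> trig_space \<nu>. 0 < L2_norm v \<and> L2_norm v \<le> 1 \<and> (\<lambda>\<theta>. v \<theta> / L2_norm v) \<in> trig_sphere \<nu>}"
  have D: "?D = punctured_ball \<inter> trig_space \<nu>" using normalize_in_sphere by auto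
  have e: "emeasure (sphere_area \<nu>) (trig_sphere \<nu>) = ennreal (real n) * emeasure P (trig_comb \<nu> -` ?D \<inter> space P)"
    unfolding emeasure_sphere_area[OF trig_sphere_sets subset_refl] D trig_volume_def P_def n_def
    by (subst emeasure_distr[OF measurable_trig_comb sets_punctured_ball]) simp
  have meas: "trig_comb \<nu> -` ?D \<inter> space P \<in> sets P"
    unfolding D P_def n_def by (rule measurable_sets[OF measurable_trig_comb sets_punctured_ball])
  have n: "n > 0" using assms by (simp add: n_def)
  have "emeasure P (Pi\<^sub>E {..<n} (\<lambda>_. {0<..<1 / real n})) = (\<Prod>i<n. emeasure lborel {0<..<1 / real n})"
    unfolding P_def by (rule emeasure_PiM) auto
  also have "\<dots> = ennreal ((1 / real n) ^ n)"
    using n by (simp add: ennreal_power)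
  finally have "0 < emeasure P (Pi\<^sub>E {..<n} (\<lambda>_. {0<..<1 / real n}))" using n by simp
  also have "\<dots> \<le> emeasure P (trig_comb \<nu> -` ?D \<inter> space P)"
  proof (rule emeasure_mono[OF _ meas], rule subsetI)
    fix x assume x: "x \<in> Pi\<^sub>E {..<n} (\<lambda>_. {0<..<1 / real n})"
    have x': "0 < x k" "x k < 1 / real n" if "k < n" for k
      using PiE_mem[OF x, of k] that by simp_all
    have "L2_set x {..<n} \<noteq> 0" using x'(1)[OF n] n by (auto simp: L2_set_eq_0_iff intro!: bexI[of _ 0])
    then have "0 < L2_set x {..<n}" using L2_set_nonneg[of x "{..<n}"] by linarith
    moreover have "L2_set x {..<n} \<le> (\<Sum>k<n. x k)" using x' by (intro L2_set_le_sum) (auto intro: less_imp_le)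
    moreover have "(\<Sum>k<n. x k) \<le> (\<Sum>k<n. 1 / real n)" using x' by (intro sum_mono) (auto intro: less_imp_le)
    ultimately have "0 < L2_set x {..<n}" "L2_set x {..<n} \<le> 1" using n by auto
    moreover have "x \<in> space P" using x by (auto simp: P_def space_PiM PiE_def)
    ultimately show "x \<in> trig_comb \<nu> -` ?D \<inter> space P"
      unfolding D by (simp add: L2_norm_trig_comb trig_comb_in n_def)
  qed
  finally show "0 < emeasure (sphere_area \<nu>) (trig_sphere \<nu>)"
    using n unfolding e by (simp add: ennreal_zero_less_mult_iff)
  have "emeasure P (trig_comb \<nu> -` ?D \<inter> space P) \<le> emeasure P (Pi\<^sub>E {..<n} (\<lambda>_. {-1..1}))"
  proof (rule emeasure_mono)
    show "trig_comb \<nu> -` ?D \<inter> space P \<subseteq> Pi\<^sub>E {..<n} (\<lambda>_. {-1..1})"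
    proof
      fix x assume x: "x \<in> trig_comb \<nu> -` ?D \<inter> space P"
      then have "L2_set x {..<n} \<le> 1" by (auto simp: L2_norm_trig_comb n_def)
      moreover have "\<bar>x k\<bar> \<le> L2_set x {..<n}" if "k < n" for k
        using member_le_L2_set[of "{..<n}" k "\<lambda>k. \<bar>x k\<bar>"] that by (simp add: L2_set_def)
      ultimately have "-1 \<le> x k \<and> x k \<le> 1" if "k < n" for k using that by (smt (verit))
      moreover have "x \<in> extensional {..<n}" using x by (simp add: P_def space_PiM PiE_def)
      ultimately show "x \<in> Pi\<^sub>E {..<n} (\<lambda>_. {-1..1})"
        by (simp add: PiE_def)
    qed
  qed (auto simp: P_def)
  also have "\<dots> = (\<Prod>i<n. emeasure lborel {-1..1::real})"
    unfolding P_def by (rule emeasure_PiM) auto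
  also have "\<dots> < \<infinity>" by (simp add: less_top[symmetric] power_eq_top_ennreal)
  finally show "emeasure (sphere_area \<nu>) (trig_sphere \<nu>) < \<infinity>"
    unfolding e by (simp add: ennreal_mult_less_top)
qed

end

theory Submission
  imports Defs "HOL-Probability.Probability_Measure" "HOL-Real_Asymp.Real_Asymp"
begin

text \<open>
  The critical points of a trigonometric polynomial with coordinate vector \<open>x\<close> are the parameters
  \<open>t\<close> for which \<open>x\<close> is orthogonal to \<open>c t\<close>, where \<open>c t\<close> is the unit vector proportional to the
  vector of derivatives of the orthonormal basis at \<open>t\<close> (\<open>deriv_curve\<close>). So the number of critical
  points is the number of times that the closed curve \<open>c\<close> on the unit sphere meets the random
  hyperplane orthogonal to \<open>x\<close>, and by Crofton's formula its mean is the length of \<open>c\<close> divided by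
  \<open>\<pi>\<close>. The inner product \<open>c s \<bullet> c t\<close> is the mean of \<open>cos (m (t - s))\<close> with weights proportional to
  \<open>m\<^sup>2\<close>, so \<open>c\<close> has constant speed \<open>\<sigma>\<close> with
  \<open>\<sigma>\<^sup>2 = (\<Sum>m\<le>\<nu>. m^4) / (\<Sum>m\<le>\<nu>. m\<^sup>2) = (3 \<nu>\<^sup>2 + 3 \<nu> - 1) / 5\<close>. The mean is
  therefore exactly \<open>2 \<sigma>\<close> (\<open>mean_crit_formula\<close>), and the asymptotics follow.

  The form of Crofton's formula that is needed (\<open>expected_count_zeros\<close>) rests on two facts. First,
  a random hyperplane separates two unit vectors with probability equal to their angle divided by \<open>\<pi>\<close>
  (\<open>prob_separated_eq_angle\<close>), because this probability is invariant under orthogonal maps and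
  additive along great circles. Orthogonal invariance comes from writing reflections as products of
  shears and a change of sign (\<open>volume_preserving_reflection\<close>). Secondly, in an interval of length
  \<open>h\<close> a zero of \<open>t \<mapsto> x \<bullet> c t\<close> without a sign change forces \<open>x \<bullet> c\<close> to be of size \<open>O(h\<^sup>2)\<close> at the left
  end, which has probability \<open>O(h\<^sup>2)\<close> only (\<open>prob_zero_in_interval\<close>). In a partition into \<open>n\<close> equal
  intervals these exceptional events contribute \<open>O(1 / n)\<close> in total, so the expected number of
  intervals with a zero tends to the length of the curve divided by \<open>\<pi>\<close>. In this way the count of
  double zeros never has to be controlled separately.

  The means are computed for the uniform distribution on the unit ball of coordinate space: since
  critical points do not change when a polynomial is multiplied by a nonzero constant, the mean over
  the sphere is the same (\<open>nn_integral_sphere_area\<close>).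
\<close>

section \<open>Lebesgue measure on coordinate space and the uniform distribution on the ball\<close>

abbreviation lebesgue_on_coords :: "'i set \<Rightarrow> ('i \<Rightarrow> real) measure" where
  "lebesgue_on_coords I \<equiv> Pi\<^sub>M I (\<lambda>_. lborel)"

definition dot :: "'i set \<Rightarrow> ('i \<Rightarrow> real) \<Rightarrow> ('i \<Rightarrow> real) \<Rightarrow> real" where
  "dot I x y = (\<Sum>k\<in>I. x k * y k)"

lemma dot_commute: "dot I x y = dot I y x"
  by (simp add: dot_def mult.commute)

lemma dot_diff_right: "dot I x (\<lambda>k. y k - z k) = dot I x y - dot I x z"
  by (simp add: dot_def right_diff_distrib sum_subtractf)

lemma dot_add_right: "dot I x (\<lambda>k. y k + z k) = dot I x y + dot I x z"
  by (simp add: dot_def distrib_left sum.distrib)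

lemma dot_scale_right: "dot I x (\<lambda>k. c * y k) = c * dot I x y"
  by (simp add: dot_def sum_distrib_left mult_ac)

lemma dot_restrict [simp]: "dot I (restrict x I) y = dot I x y" "dot I x (restrict y I) = dot I x y"
  by (simp_all add: dot_def)

lemma dot_cong: "(\<And>k. k \<in> I \<Longrightarrow> x k = x' k) \<Longrightarrow> (\<And>k. k \<in> I \<Longrightarrow> y k = y' k) \<Longrightarrow> dot I x y = dot I x' y'"
  by (simp add: dot_def)

lemma dot_self_nonneg: "0 \<le> dot I x x"
  by (simp add: dot_def sum_nonneg)

lemma dot_self_eq_0: "finite I \<Longrightarrow> dot I x x = 0 \<Longrightarrow> k \<in> I \<Longrightarrow> x k = 0"
  by (simp add: dot_def sum_nonneg_eq_0_iff)

lemma L2_set_dot: "L2_set x I = sqrt (dot I x x)"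
  by (simp add: L2_set_def dot_def power2_eq_square)

lemma dot_le_norms: "\<bar>dot I x y\<bar> \<le> L2_set x I * L2_set y I"
proof -
  have "\<bar>dot I x y\<bar> \<le> (\<Sum>k\<in>I. \<bar>x k\<bar> * \<bar>y k\<bar>)"
    unfolding dot_def by (rule order_trans[OF sum_abs]) (simp add: abs_mult)
  also have "\<dots> \<le> L2_set x I * L2_set y I" by (rule L2_set_mult_ineq)
  finally show ?thesis .
qed

lemma borel_measurable_coordinate:
  "i \<in> I \<Longrightarrow> (\<lambda>x. x i) \<in> borel_measurable (lebesgue_on_coords I)"
  using measurable_component_singleton[of i I "\<lambda>_. lborel"] by simp

lemma borel_measurable_dot [measurable]:
  "(\<lambda>x. dot I x y) \<in> borel_measurable (lebesgue_on_coords I)"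
proof -
  have "(\<lambda>x. x k * y k) \<in> borel_measurable (lebesgue_on_coords I)" if "k \<in> I" for k
    using measurable_component_singleton[OF that, of "\<lambda>_. lborel"]
    by (intro borel_measurable_times borel_measurable_const) auto
  then show ?thesis unfolding dot_def by (rule borel_measurable_sum)
qed

text \<open>
  The origin is left out so that every point of the ball has a direction: the radial projection of
  this set is the unit sphere.
\<close>
definition punctured_unit_ball :: "'i set \<Rightarrow> ('i \<Rightarrow> real) set" where
  "punctured_unit_ball I = {x \<in> space (lebesgue_on_coords I). 0 < dot I x x \<and> dot I x x \<le> 1}"

definition uniform_ball :: "'i set \<Rightarrow> ('i \<Rightarrow> real) measure" where
  "uniform_ball I = uniform_measure (lebesgue_on_coords I) (punctured_unit_ball I)"

lemma borel_measurable_dot_self [measurable]: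
  "(\<lambda>x. dot I x x) \<in> borel_measurable (lebesgue_on_coords I)"
proof -
  have "(\<lambda>x. x k * x k) \<in> borel_measurable (lebesgue_on_coords I)" if "k \<in> I" for k
    using measurable_component_singleton[OF that, of "\<lambda>_. lborel"]
    by (intro borel_measurable_times borel_measurable_const) auto
  then show ?thesis unfolding dot_def by (rule borel_measurable_sum)
qed

lemma sets_punctured_unit_ball [measurable]:
  "punctured_unit_ball I \<in> sets (lebesgue_on_coords I)"
  unfolding punctured_unit_ball_def by measurable

lemma sets_uniform_ball [measurable_cong, simp]: "sets (uniform_ball I) = sets (lebesgue_on_coords I)"
  by (simp add: uniform_ball_def)

lemma space_uniform_ball [simp]: "space (uniform_ball I) = space (lebesgue_on_coords I)"
  by (simp add: uniform_ball_def)

lemma unit_ball_coordinate_le: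
  assumes "finite I" "dot I x x \<le> 1" "k \<in> I"
  shows "\<bar>x k\<bar> \<le> 1"
proof -
  have "x k * x k \<le> dot I x x"
    unfolding dot_def using assms by (intro member_le_sum) auto
  then have "(x k)\<^sup>2 \<le> 1" using assms by (simp add: power2_eq_square)
  then show ?thesis by (simp add: abs_square_le_1)
qed

lemma emeasure_box:
  assumes "finite I" "\<And>k. k \<in> I \<Longrightarrow> a k \<le> b k"
  shows "emeasure (lebesgue_on_coords I) (Pi\<^sub>E I (\<lambda>k. {a k..b k})) = ennreal (\<Prod>k\<in>I. b k - a k)"
proof -
  interpret product_sigma_finite "\<lambda>_. lborel :: real measure" by standard
  have "emeasure (lebesgue_on_coords I) (Pi\<^sub>E I (\<lambda>k. {a k..b k})) = (\<Prod>k\<in>I. emeasure lborel {a k..b k})"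
    using assms by (intro emeasure_PiM) auto
  also have "\<dots> = (\<Prod>k\<in>I. ennreal (b k - a k))" using assms by (intro prod.cong) auto
  also have "\<dots> = ennreal (\<Prod>k\<in>I. b k - a k)" using assms by (intro prod_ennreal) auto
  finally show ?thesis .
qed

lemma emeasure_punctured_unit_ball:
  assumes "finite I" "I \<noteq> {}"
  shows "0 < emeasure (lebesgue_on_coords I) (punctured_unit_ball I)"
    and "emeasure (lebesgue_on_coords I) (punctured_unit_ball I) < \<infinity>"
proof -
  let ?P = "lebesgue_on_coords I" and ?B = "punctured_unit_ball I"
  \<comment> \<open>The box \<open>[r/2, r]\<close> in every coordinate lies in the ball, since \<open>card I \<cdot> r\<^sup>2 \<le> 1\<close>.\<close>
  define r where "r = 1 / (real (card I))"
  have cI: "real (card I) \<ge> 1" using assms by (simp add: Suc_le_eq card_gt_0_iff)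
  then have r: "0 < r" "r \<le> 1" "card I * r = 1" by (auto simp: r_def)
  have "0 < emeasure ?P (Pi\<^sub>E I (\<lambda>_. {r/2..r}))"
    using r assms by (subst emeasure_box) (auto intro!: prod_pos)
  also have "\<dots> \<le> emeasure ?P ?B"
  proof (rule emeasure_mono[OF subsetI sets_punctured_unit_ball])
    fix x assume x: "x \<in> Pi\<^sub>E I (\<lambda>_. {r/2..r})"
    then have xk: "r/2 \<le> x k" "x k \<le> r" if "k \<in> I" for k using that by (auto simp: PiE_iff)
    have "dot I x x \<le> (\<Sum>k\<in>I. r * 1)" unfolding dot_def
      using xk r by (intro sum_mono mult_mono) (auto, smt+)
    moreover have "0 < dot I x x" unfolding dot_def
      using xk r assms by (intro sum_pos) (force+)
    ultimately show "x \<in> ?B" using x r by (auto simp: punctured_unit_ball_def space_PiM PiE_iff)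
  qed
  finally show "0 < emeasure ?P ?B" .
  have "emeasure ?P ?B \<le> emeasure ?P (Pi\<^sub>E I (\<lambda>_. {-1..1}))"
  proof (rule emeasure_mono[OF subsetI])
    fix x assume x: "x \<in> ?B"
    then have "\<bar>x k\<bar> \<le> 1" if "k \<in> I" for k
      using unit_ball_coordinate_le[OF assms(1) _ that] by (simp add: punctured_unit_ball_def)
    then show "x \<in> Pi\<^sub>E I (\<lambda>_. {-1..1})"
      using x by (auto simp: punctured_unit_ball_def space_PiM PiE_iff abs_le_iff)
  next
    show "Pi\<^sub>E I (\<lambda>_. {-1..1}) \<in> sets ?P" using assms by (intro sets_PiM_I_finite) auto
  qed
  also have "\<dots> < \<infinity>" using assms by (subst emeasure_box) auto
  finally show "emeasure ?P ?B < \<infinity>" .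
qed

lemma prob_space_uniform_ball:
  assumes "finite I" "I \<noteq> {}"
  shows "prob_space (uniform_ball I)"
  unfolding uniform_ball_def using emeasure_punctured_unit_ball[OF assms]
  by (intro prob_space_uniform_measure) auto

section \<open>Orthogonal invariance\<close>

definition volume_preserving :: "'i set \<Rightarrow> (('i \<Rightarrow> real) \<Rightarrow> 'i \<Rightarrow> real) \<Rightarrow> bool" where
  "volume_preserving I T \<longleftrightarrow> T \<in> measurable (lebesgue_on_coords I) (lebesgue_on_coords I) \<and>
     distr (lebesgue_on_coords I) (lebesgue_on_coords I) T = lebesgue_on_coords I"

lemma volume_preserving_comp:
  "volume_preserving I S \<Longrightarrow> volume_preserving I T \<Longrightarrow> volume_preserving I (\<lambda>x. T (S x))"
  unfolding volume_preserving_def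
  using distr_distr[of T "lebesgue_on_coords I" "lebesgue_on_coords I" S "lebesgue_on_coords I"]
  by (auto simp: comp_def intro: measurable_compose)

text \<open>
  Fubini reduces the claim to one-dimensional affine maps \<open>y \<mapsto> s y + L\<close> with \<open>\<bar>s\<bar> = 1\<close>: once the other
  coordinates are fixed, \<open>L\<close> is a constant, because it ignores the coordinate \<open>i\<close>.
\<close>
lemma volume_preserving_coordinate_update:
  fixes L :: "('i \<Rightarrow> real) \<Rightarrow> real"
  assumes "finite I" "i \<in> I" and [measurable]: "L \<in> borel_measurable (lebesgue_on_coords I)"
    and indep: "\<And>x y. L (x(i := y)) = L x" and s: "\<bar>s\<bar> = 1"
  shows "volume_preserving I (\<lambda>x. x(i := s * x i + L x))"
proof -
  interpret product_sigma_finite "\<lambda>_. lborel :: real measure" by standard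
  define J where "J = I - {i}"
  have J: "I = insert i J" "finite J" "i \<notin> J" using assms by (auto simp: J_def)
  let ?P = "lebesgue_on_coords I" and ?T = "\<lambda>x. x(i := s * x i + L x)"
  have T [measurable]: "?T \<in> measurable ?P ?P"
  proof (rule measurable_PiM_single')
    show "(\<lambda>x. ?T x k) \<in> measurable ?P lborel" if "k \<in> I" for k
      using \<open>i \<in> I\<close> that by (cases "k = i") auto
    show "?T \<in> space ?P \<rightarrow> (\<Pi>\<^sub>E k\<in>I. space lborel)"
      using \<open>i \<in> I\<close> by (auto simp: space_PiM PiE_iff extensional_def)
  qed
  have "distr ?P ?P ?T = ?P"
  proof (rule measure_eqI)
    fix A assume "A \<in> sets (distr ?P ?P ?T)"
    then have A [measurable]: "A \<in> sets ?P" by simp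
    have upd: "(\<lambda>y. x(i := y)) \<in> measurable lborel ?P" if "x \<in> space (lebesgue_on_coords J)" for x
      using that J by (intro measurable_PiM_single') (auto simp: space_PiM PiE_iff extensional_def)
    have "emeasure (distr ?P ?P ?T) A = (\<integral>\<^sup>+x. indicator A (?T x) \<partial>?P)"
      by (subst emeasure_distr) (auto simp flip: nn_integral_indicator intro!: nn_integral_cong split: split_indicator)
    also have "\<dots> = (\<integral>\<^sup>+x. \<integral>\<^sup>+y. indicator A (?T (x(i := y))) \<partial>lborel \<partial>lebesgue_on_coords J)"
      unfolding J(1) by (rule product_nn_integral_insert) (use J in \<open>auto simp flip: J(1)\<close>)
    also have "\<dots> = (\<integral>\<^sup>+x. \<integral>\<^sup>+y. indicator A (x(i := y)) \<partial>lborel \<partial>lebesgue_on_coords J)"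
    proof (rule nn_integral_cong)
      fix x assume x: "x \<in> space (lebesgue_on_coords J)"
      have "(\<lambda>y. indicator A (x(i := y)) :: ennreal) \<in> borel_measurable lborel"
        using upd[OF x] by measurable
      then have "(\<integral>\<^sup>+y. indicator A (x(i := y)) \<partial>lborel) = ennreal \<bar>s\<bar> * (\<integral>\<^sup>+y. indicator A (x(i := L x + s * y)) \<partial>lborel)"
        using s by (intro nn_integral_real_affine) auto
      then show "(\<integral>\<^sup>+y. indicator A (?T (x(i := y))) \<partial>lborel) = (\<integral>\<^sup>+y. indicator A (x(i := y)) \<partial>lborel)"
        using s by (simp add: indep add.commute)
    qed
    also have "\<dots> = (\<integral>\<^sup>+x. indicator A x \<partial>?P)"
      unfolding J(1) by (rule product_nn_integral_insert[symmetric]) (use J in \<open>auto simp flip: J(1)\<close>)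
    finally show "emeasure (distr ?P ?P ?T) A = emeasure ?P A" by simp
  qed simp
  with T show ?thesis by (simp add: volume_preserving_def)
qed


text \<open>
  The Householder reflection in the hyperplane orthogonal to \<open>v\<close>. If \<open>v\<close> vanishes on \<open>I\<close>, division by
  zero makes it the identity, which spares case distinctions below.
\<close>
definition reflection :: "'i set \<Rightarrow> ('i \<Rightarrow> real) \<Rightarrow> ('i \<Rightarrow> real) \<Rightarrow> 'i \<Rightarrow> real" where
  "reflection I v x = (\<lambda>k\<in>I. x k - 2 * dot I x v / dot I v v * v k)"

lemma measurable_reflection [measurable]:
  "reflection I v \<in> measurable (lebesgue_on_coords I) (lebesgue_on_coords I)"
proof -
  have "(\<lambda>x. x k - 2 * dot I x v / dot I v v * v k) \<in> measurable (lebesgue_on_coords I) lborel" if "k \<in> I" for k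
    using borel_measurable_diff[OF borel_measurable_coordinate[OF that],
      of "\<lambda>x. 2 * dot I x v / dot I v v * v k"] by simp
  then show ?thesis unfolding reflection_def by (rule measurable_restrict)
qed

lemma dot_reflection_right:
  "dot I x (reflection I v y) = dot I x y - 2 * dot I y v / dot I v v * dot I x v"
  unfolding reflection_def dot_restrict dot_diff_right dot_scale_right ..

lemma dot_reflection: "dot I (reflection I v x) y = dot I x (reflection I v y)"
  by (simp add: dot_commute[of I _ y] dot_reflection_right)

lemma reflection_reflection:
  assumes "finite I" "x \<in> extensional I"
  shows "reflection I v (reflection I v x) = x"
proof (cases "dot I v v = 0")
  case True
  then show ?thesis using assms dot_self_eq_0[OF assms(1) True]
    by (auto simp: reflection_def fun_eq_iff extensional_def)
next
  case False
  have "dot I (reflection I v x) v = - dot I x v"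
    unfolding dot_reflection using False by (simp add: dot_reflection_right)
  then show ?thesis using assms
    by (subst reflection_def) (auto simp: reflection_def fun_eq_iff extensional_def)
qed

lemma dot_reflection_reflection:
  assumes "finite I"
  shows "dot I (reflection I v x) (reflection I v y) = dot I x y"
proof -
  have "reflection I v (reflection I v (restrict y I)) = restrict y I"
    by (intro reflection_reflection assms) auto
  moreover have "reflection I v (restrict y I) = reflection I v y"
    by (auto simp: reflection_def fun_eq_iff)
  ultimately have "dot I x (reflection I v (reflection I v y)) = dot I x (restrict y I)" by simp
  then show ?thesis by (simp only: dot_reflection dot_restrict)
qed

text \<open>
  Vectors \<open>u\<close> and \<open>u'\<close> of equal length are mirror images in the hyperplane orthogonal to
  \<open>u - u'\<close>.
\<close>
lemma reflection_swaps:
  assumes "finite I" "dot I u u = dot I u' u'" "k \<in> I"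
  shows "reflection I (\<lambda>k. u k - u' k) u k = u' k"
proof -
  let ?v = "\<lambda>k. u k - u' k"
  have v: "dot I ?v ?v = 2 * dot I u ?v"
    using assms(2) by (simp add: dot_diff_right dot_commute[of I ?v] dot_commute[of I u' u])
  show ?thesis
  proof (cases "dot I ?v ?v = 0")
    case True
    then show ?thesis using dot_self_eq_0[OF assms(1) True assms(3)] assms(3) by (simp add: reflection_def)
  next
    case False
    then show ?thesis using assms(3) v by (simp add: reflection_def)
  qed
qed

text \<open>
  The other coordinates may be changed one at a time, since the coordinate \<open>i\<close> that drives the
  shear stays fixed throughout.
\<close>
lemma volume_preserving_shear:
  assumes "finite I" "i \<in> I" "J \<subseteq> I - {i}"
  shows "volume_preserving I (\<lambda>x k. if k \<in> J then x k + c k * x i else x k)"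
proof -
  define T where "T = (\<lambda>J (x :: 'a \<Rightarrow> real) k. if k \<in> J then x k + c k * x i else x k)"
  have "finite J" using assms finite_subset by blast
  then have "volume_preserving I (T J)" using assms(3)
  proof induction
    case empty
    then show ?case by (simp add: T_def volume_preserving_def distr_id2)
  next
    case (insert j J)
    have "volume_preserving I (\<lambda>x. x(j := 1 * x j + c j * x i))"
      by (rule volume_preserving_coordinate_update)
        (use insert.prems assms in \<open>auto intro!: borel_measurable_times borel_measurable_coordinate\<close>)
    moreover have "T (insert j J) = (\<lambda>x. (T J x)(j := 1 * T J x j + c j * T J x i))"
      using insert by (auto simp: T_def fun_eq_iff)
    moreover have "volume_preserving I (T J)" using insert by auto
    ultimately show ?case
      using volume_preserving_comp[of I "T J" "\<lambda>x. x(j := 1 * x j + c j * x i)"] by (simp only:)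
  qed
  then show ?thesis by (simp add: T_def)
qed

text \<open>
  The reflection is a product of shears and a change of sign, which preserve volume. Choose \<open>i\<close> with
  \<open>v i \<noteq> 0\<close>. The map \<open>S\<close> replaces the \<open>i\<close>-th coordinate by \<open>s = (x \<bullet> v) / v i\<close>, in terms of which the
  reflection is \<open>s \<mapsto> - s\<close> together with a translation of the other coordinates by multiples of \<open>s\<close>.
  The map \<open>T\<close> is this translation, and \<open>R\<close> combines the change of sign with the inverse of \<open>S\<close>.
\<close>
lemma volume_preserving_reflection:
  assumes "finite I"
  shows "volume_preserving I (reflection I v)"
proof (cases "dot I v v = 0")
  case True
  have "reflection I v x = x" if "x \<in> space (lebesgue_on_coords I)" for x
    using that dot_self_eq_0[OF assms True]
    by (auto simp: reflection_def fun_eq_iff space_PiM PiE_iff extensional_def)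
  then show ?thesis
    by (simp add: volume_preserving_def measurable_reflection distr_id2 cong: distr_cong)
next
  case False
  have "\<exists>i\<in>I. v i \<noteq> 0"
  proof (rule ccontr)
    assume "\<not> ?thesis"
    then have "dot I v v = 0" unfolding dot_def by (intro sum.neutral) auto
    with False show "False" ..
  qed
  then obtain i where i: "i \<in> I" "v i \<noteq> 0" by blast
  define J where "J = I - {i}"
  define L where "L = (\<lambda>x. dot J x (\<lambda>k. v k / v i))"
  have split: "dot I x y = x i * y i + dot J x y" for x y
    unfolding dot_def J_def using i(1) assms by (subst sum.remove[of I i]) auto
  have L: "L \<in> borel_measurable (lebesgue_on_coords I)"
    unfolding L_def dot_def by (intro borel_measurable_sum borel_measurable_times borel_measurable_const
      borel_measurable_coordinate) (auto simp: J_def)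
  have L_upd: "L (x(i := y)) = L x" for x y by (auto simp: L_def dot_def J_def intro!: sum.cong)
  define S where "S = (\<lambda>x. x(i := 1 * x i + L x))"
  define T where "T = (\<lambda>x k. if k \<in> J then x k + (- 2 * v i * v k / dot I v v) * x i else x k)"
  define R where "R = (\<lambda>x. x(i := (-1) * x i + - L x))"
  have S: "volume_preserving I S" unfolding S_def
    by (rule volume_preserving_coordinate_update[OF assms i(1) L L_upd]) simp
  have T: "volume_preserving I T" unfolding T_def
    by (rule volume_preserving_shear[OF assms i(1)]) (simp add: J_def)
  have R: "volume_preserving I R" unfolding R_def
    by (rule volume_preserving_coordinate_update[OF assms i(1)]) (use L L_upd in auto)
  have "volume_preserving I (\<lambda>x. R (T (S x)))"
    by (rule volume_preserving_comp[OF volume_preserving_comp[OF S T] R])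
  moreover have "R (T (S x)) = reflection I v x" if x: "x \<in> space (lebesgue_on_coords I)" for x
  proof -
    define s where "s = x i + L x"
    have s: "dot I x v = v i * s"
    proof -
      have "L x = dot J x v / v i" by (simp add: L_def dot_def sum_divide_distrib)
      then show ?thesis using i(2) by (simp add: s_def split field_simps)
    qed
    have "L (T (S x)) = L x - 2 * s * dot J v v / dot I v v"
    proof -
      have "L (T (S x)) = (\<Sum>k\<in>J. x k * (v k / v i) - 2 * s / dot I v v * (v k * v k))"
        unfolding L_def dot_def[of J] using i(2) False
        by (intro sum.cong) (auto simp: T_def S_def s_def J_def field_simps)
      then show ?thesis
        by (simp add: sum_subtractf L_def dot_def[of J] sum_distrib_left sum_divide_distrib)
    qed
    also have "dot J v v = dot I v v - v i * v i" by (simp add: split)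
    finally have LT: "L (T (S x)) = L x - 2 * s + 2 * s * (v i * v i) / dot I v v"
      using False by (simp add: field_simps)
    have "R (T (S x)) k = reflection I v x k" for k
    proof (cases "k \<in> I")
      case True
      show ?thesis
      proof (cases "k = i")
        case True
        then show ?thesis using i LT s
          by (simp add: R_def reflection_def) (simp add: T_def S_def J_def s_def)
      next
        case False
        then show ?thesis using True s
          by (simp add: R_def reflection_def T_def J_def) (simp add: S_def s_def)
      qed
    next
      case False
      then show ?thesis using x i(1)
        by (auto simp: R_def T_def S_def J_def reflection_def space_PiM PiE_iff extensional_def)
    qed
    then show ?thesis by blast
  qed
  ultimately show ?thesis
    using distr_cong[OF refl refl, of "lebesgue_on_coords I" "\<lambda>x. R (T (S x))" "reflection I v" "lebesgue_on_coords I"]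
    by (simp add: volume_preserving_def measurable_reflection)
qed

lemma distr_uniform_ball_reflection:
  assumes "finite I"
  shows "distr (uniform_ball I) (uniform_ball I) (reflection I v) = uniform_ball I"
proof (rule measure_eqI)
  fix A assume "A \<in> sets (distr (uniform_ball I) (uniform_ball I) (reflection I v))"
  then have A [measurable]: "A \<in> sets (lebesgue_on_coords I)" by simp
  let ?P = "lebesgue_on_coords I" and ?H = "reflection I v" and ?B = "punctured_unit_ball I"
  have pre: "?H -` A \<inter> space ?P \<in> sets ?P" using measurable_reflection A by (rule measurable_sets)
  have "?B \<inter> (?H -` A \<inter> space ?P) = ?H -` (?B \<inter> A) \<inter> space ?P"
    using measurable_space[OF measurable_reflection]
    by (auto simp: punctured_unit_ball_def dot_reflection_reflection[OF assms])
  then have "emeasure ?P (?B \<inter> (?H -` A \<inter> space ?P)) = emeasure (distr ?P ?P ?H) (?B \<inter> A)"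
    by (subst emeasure_distr) auto
  also have "\<dots> = emeasure ?P (?B \<inter> A)"
    using volume_preserving_reflection[OF assms] by (simp add: volume_preserving_def)
  finally show "emeasure (distr (uniform_ball I) (uniform_ball I) ?H) A = emeasure (uniform_ball I) A"
    using pre by (subst emeasure_distr) (auto simp: uniform_ball_def)
qed simp

lemma distr_dot_pair_reflection:
  assumes "finite I"
  shows "distr (uniform_ball I) (borel \<Otimes>\<^sub>M borel) (\<lambda>x. (dot I x (reflection I v u), dot I x (reflection I v w)))
    = distr (uniform_ball I) (borel \<Otimes>\<^sub>M borel) (\<lambda>x. (dot I x u, dot I x w))"
proof -
  have "distr (uniform_ball I) (borel \<Otimes>\<^sub>M borel) (\<lambda>x. (dot I x u, dot I x w))
    = distr (distr (uniform_ball I) (uniform_ball I) (reflection I v)) (borel \<Otimes>\<^sub>M borel) (\<lambda>x. (dot I x u, dot I x w))"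
    by (simp add: distr_uniform_ball_reflection[OF assms])
  also have "\<dots> = distr (uniform_ball I) (borel \<Otimes>\<^sub>M borel)
      (\<lambda>x. (dot I (reflection I v x) u, dot I (reflection I v x) w))"
    by (subst distr_distr) (auto simp: comp_def)
  finally show ?thesis by (simp add: dot_reflection)
qed

text \<open>
  Two pairs of vectors with the same Gram matrix differ by two reflections: the first takes \<open>u\<close> to
  \<open>u'\<close>; the second takes the image of \<open>w\<close> to \<open>w'\<close> and fixes \<open>u'\<close>, because its axis is orthogonal to
  \<open>u'\<close>. The uniform distribution on the ball is invariant under both.
\<close>
lemma distr_dot_pair_Gram:
  assumes "finite I" "dot I u u = dot I u' u'" "dot I w w = dot I w' w'" "dot I u w = dot I u' w'"
  shows "distr (uniform_ball I) (borel \<Otimes>\<^sub>M borel) (\<lambda>x. (dot I x u, dot I x w))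
    = distr (uniform_ball I) (borel \<Otimes>\<^sub>M borel) (\<lambda>x. (dot I x u', dot I x w'))"
proof -
  define v where "v = (\<lambda>k. u k - u' k)"
  define w1 where "w1 = reflection I v w"
  have u': "reflection I v u k = u' k" if "k \<in> I" for k
    unfolding v_def using assms that by (intro reflection_swaps) auto
  have w1: "dot I w1 w1 = dot I w' w'"
    unfolding w1_def dot_reflection_reflection[OF assms(1)] by (rule assms)
  have "dot I u' w1 = dot I (reflection I v u) w1" by (intro dot_cong) (auto simp: u')
  also have "\<dots> = dot I u w" unfolding w1_def
    by (rule dot_reflection_reflection[OF assms(1)])
  finally have uw: "dot I u' w1 = dot I u' w'" using assms by simp
  define z where "z = (\<lambda>k. w1 k - w' k)"
  have "dot I u' z = 0" using uw by (simp add: z_def dot_diff_right)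
  then have u'2: "reflection I z u' k = u' k" if "k \<in> I" for k using that by (simp add: reflection_def)
  have w': "reflection I z w1 k = w' k" if "k \<in> I" for k
    unfolding z_def using assms(1) w1 that by (intro reflection_swaps) auto
  have c: "(\<lambda>x. (dot I x a, dot I x b)) = (\<lambda>x. (dot I x a', dot I x b'))"
    if "\<And>k. k \<in> I \<Longrightarrow> a k = a' k" "\<And>k. k \<in> I \<Longrightarrow> b k = b' k" for a a' b b' :: "'a \<Rightarrow> real"
    using that by (auto simp: dot_def fun_eq_iff)
  have "distr (uniform_ball I) (borel \<Otimes>\<^sub>M borel) (\<lambda>x. (dot I x u, dot I x w))
    = distr (uniform_ball I) (borel \<Otimes>\<^sub>M borel) (\<lambda>x. (dot I x (reflection I v u), dot I x w1))"
    unfolding w1_def by (rule distr_dot_pair_reflection[OF assms(1), symmetric])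
  also have "\<dots> = distr (uniform_ball I) (borel \<Otimes>\<^sub>M borel) (\<lambda>x. (dot I x u', dot I x w1))"
    using c[of "reflection I v u" u' w1 w1] u' by simp
  also have "\<dots> = distr (uniform_ball I) (borel \<Otimes>\<^sub>M borel)
      (\<lambda>x. (dot I x (reflection I z u'), dot I x (reflection I z w1)))"
    by (rule distr_dot_pair_reflection[OF assms(1), symmetric])
  also have "\<dots> = distr (uniform_ball I) (borel \<Otimes>\<^sub>M borel) (\<lambda>x. (dot I x u', dot I x w'))"
    using c[of "reflection I z u'" u' "reflection I z w1" w'] u'2 w' by simp
  finally show ?thesis .
qed

section \<open>Separation by a random hyperplane\<close>

lemma prob_dot_pair_Gram:
  assumes "finite I" "dot I u u = dot I u' u'" "dot I w w = dot I w' w'" "dot I u w = dot I u' w'"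
    and A: "Measurable.pred (borel \<Otimes>\<^sub>M borel) (\<lambda>(a, b). Q a b)"
  shows "measure (uniform_ball I) {x \<in> space (lebesgue_on_coords I). Q (dot I x u) (dot I x w)}
    = measure (uniform_ball I) {x \<in> space (lebesgue_on_coords I). Q (dot I x u') (dot I x w')}"
proof -
  define S where "S = {p :: real \<times> real. Q (fst p) (snd p)}"
  have S: "S \<in> sets (borel \<Otimes>\<^sub>M borel)"
    using A by (simp add: S_def pred_def space_pair_measure case_prod_unfold)
  have "measure (distr (uniform_ball I) (borel \<Otimes>\<^sub>M borel) (\<lambda>x. (dot I x u, dot I x w))) S
    = measure (uniform_ball I) {x \<in> space (lebesgue_on_coords I). Q (dot I x u) (dot I x w)}" for u w
    by (subst measure_distr[OF _ S]) (auto simp: S_def intro!: arg_cong[of _ _ "measure (uniform_ball I)"])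
  then show ?thesis using distr_dot_pair_Gram[OF assms(1-4)] by metis
qed

text \<open>
  By orthogonal invariance \<open>u\<close> may be taken to be a coordinate vector; the part of the ball in
  question then lies in a box that has one side of length \<open>2 \<epsilon>\<close> and all others of length \<open>2\<close>.
\<close>
lemma prob_slab_le:
  assumes "finite I" "I \<noteq> {}"
  obtains C where "C \<ge> 0" "\<And>u \<epsilon>. dot I u u = 1 \<Longrightarrow> \<epsilon> \<ge> 0 \<Longrightarrow>
    measure (uniform_ball I) {x \<in> space (lebesgue_on_coords I). \<bar>dot I x u\<bar> \<le> \<epsilon>} \<le> C * \<epsilon>"
proof -
  let ?P = "lebesgue_on_coords I" and ?B = "punctured_unit_ball I" and ?U = "uniform_ball I"
  interpret prob_space ?U using assms by (rule prob_space_uniform_ball)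
  obtain i where i: "i \<in> I" using assms by blast
  define V where "V = measure ?P ?B"
  have V: "V > 0" "emeasure ?P ?B = ennreal V"
    using emeasure_punctured_unit_ball[OF assms]
    by (auto simp: V_def measure_def enn2real_positive_iff)
  show thesis
  proof (rule that[of "2 ^ card I / V"])
    show "0 \<le> 2 ^ card I / V" using V by simp
    fix u and \<epsilon> :: real assume u: "dot I u u = 1" and \<epsilon>: "\<epsilon> \<ge> 0"
    define e where "e = (\<lambda>k. if k = i then 1 else 0 :: real)"
    have dot_e: "dot I x e = x i" for x
      unfolding dot_def e_def using i assms(1) by (simp add: if_distrib[of "(*) _"] cong: if_cong)
    define S where "S = {x \<in> space ?P. \<bar>x i\<bar> \<le> \<epsilon>}"
    have S[measurable]: "S \<in> sets ?P"
      unfolding S_def using borel_measurable_coordinate[OF i] by measurable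
    have "measure ?U {x \<in> space ?P. \<bar>dot I x u\<bar> \<le> \<epsilon>} = measure ?U {x \<in> space ?P. \<bar>dot I x e\<bar> \<le> \<epsilon>}"
      by (rule prob_dot_pair_Gram[where Q = "\<lambda>a b. \<bar>a\<bar> \<le> \<epsilon>" and w = u and w' = e])
        (use assms u dot_e[of e] in \<open>auto simp: e_def\<close>)
    also have "\<dots> = measure ?U S" by (simp add: dot_e S_def)
    finally have eq: "measure ?U {x \<in> space ?P. \<bar>dot I x u\<bar> \<le> \<epsilon>} = measure ?U S" .
    define r where "r = (\<lambda>k. if k = i then \<epsilon> else 1)"
    have "emeasure ?P (?B \<inter> S) \<le> emeasure ?P (Pi\<^sub>E I (\<lambda>k. {- r k..r k}))"
    proof (rule emeasure_mono[OF subsetI])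
      fix x assume x: "x \<in> ?B \<inter> S"
      then have "\<bar>x k\<bar> \<le> 1" if "k \<in> I" for k
        using unit_ball_coordinate_le[OF assms(1) _ that] by (simp add: punctured_unit_ball_def)
      then show "x \<in> Pi\<^sub>E I (\<lambda>k. {- r k..r k})"
        using x by (auto simp: punctured_unit_ball_def space_PiM PiE_iff abs_le_iff r_def S_def)
    qed (use assms in \<open>auto intro: sets_PiM_I_finite\<close>)
    also have "\<dots> = ennreal (\<Prod>k\<in>I. r k - - r k)"
      by (rule emeasure_box) (use assms \<epsilon> in \<open>auto simp: r_def\<close>)
    also have "(\<Prod>k\<in>I. r k - - r k) = 2 ^ card I * (\<Prod>k\<in>I. r k)"
      by (simp add: prod.distrib[symmetric] flip: prod_constant)
    also have "(\<Prod>k\<in>I. r k) = \<epsilon>"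
      unfolding r_def using assms i by simp
    finally have "emeasure ?P (?B \<inter> S) \<le> ennreal (2 ^ card I * \<epsilon>)" .
    then have "emeasure ?U S \<le> ennreal (2 ^ card I * \<epsilon>) / ennreal V"
      unfolding uniform_ball_def using V(2) by (simp add: divide_right_mono_ennreal)
    also have "\<dots> = ennreal (2 ^ card I / V * \<epsilon>)"
      using V \<epsilon> by (subst divide_ennreal) auto
    finally show "measure ?U {x \<in> space ?P. \<bar>dot I x u\<bar> \<le> \<epsilon>} \<le> 2 ^ card I / V * \<epsilon>"
      unfolding eq emeasure_eq_measure using V \<epsilon> by simp
  qed
qed

lemma prob_hyperplane_eq_0:
  assumes "finite I" "dot I u u = 1"
  shows "measure (uniform_ball I) {x \<in> space (lebesgue_on_coords I). dot I x u = 0} = 0"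
proof -
  have "I \<noteq> {}" using assms by (auto simp: dot_def)
  then obtain C where "measure (uniform_ball I) {x \<in> space (lebesgue_on_coords I). \<bar>dot I x u\<bar> \<le> 0} \<le> C * 0"
    by (rule prob_slab_le[OF assms(1)]) (use assms(2) in blast)
  then show ?thesis by (simp add: measure_le_0_iff)
qed

text \<open>
  The random point \<open>x\<close> stands for the hyperplane orthogonal to it, and the event is that \<open>u\<close>
  and \<open>w\<close> lie strictly on opposite sides of it.
\<close>
definition prob_separated :: "'i set \<Rightarrow> ('i \<Rightarrow> real) \<Rightarrow> ('i \<Rightarrow> real) \<Rightarrow> real" where
  "prob_separated I u w =
     measure (uniform_ball I) {x \<in> space (lebesgue_on_coords I). dot I x u * dot I x w < 0}"

lemma prob_separated_Gram:
  assumes "finite I" "dot I u u = dot I u' u'" "dot I w w = dot I w' w'" "dot I u w = dot I u' w'"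
  shows "prob_separated I u w = prob_separated I u' w'"
  unfolding prob_separated_def
  by (rule prob_dot_pair_Gram[OF assms, where Q = "\<lambda>a b. a * b < 0"]) measurable

text \<open>
  Almost surely the hyperplane avoids \<open>u\<close>, \<open>v\<close> and \<open>w\<close>. If \<open>v\<close> lies on a shortest arc from \<open>u\<close> to
  \<open>w\<close>, then a hyperplane that separates \<open>u\<close> from \<open>w\<close> crosses this arc exactly once, and any other
  does not cross it at all. For antipodal \<open>u\<close> and \<open>w\<close> every \<open>v\<close> lies on such an arc, which is the first
  alternative.
\<close>
lemma prob_separated_additive:
  assumes I: "finite I" and unit: "dot I u u = 1" "dot I v v = 1" "dot I w w = 1"
    and between: "(\<forall>k\<in>I. w k = - u k) \<or>
      (\<exists>a b. 0 \<le> a \<and> 0 \<le> b \<and> (\<forall>k\<in>I. v k = a * u k + b * w k))"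
  shows "prob_separated I u w = prob_separated I u v + prob_separated I v w"
proof -
  let ?P = "lebesgue_on_coords I" and ?U = "uniform_ball I"
  have "I \<noteq> {}" using unit by (auto simp: dot_def)
  then interpret prob_space ?U using I by (intro prob_space_uniform_ball)
  define D where "D = (\<lambda>a b. {x \<in> space ?P. dot I x a * dot I x b < 0})"
  define Z where "Z = (\<lambda>a. {x \<in> space ?P. dot I x a = 0})"
  have D [measurable]: "D a b \<in> sets ?P" for a b unfolding D_def by measurable
  have Z [measurable]: "Z a \<in> sets ?P" for a unfolding Z_def by measurable
  have null: "AE x in ?U. x \<notin> Z a" if "dot I a a = 1" for a
    using prob_hyperplane_eq_0[OF I that]
    by (intro AE_not_in null_setsI) (auto simp: Z_def emeasure_eq_measure)
  have AE: "AE x in ?U. (x \<in> D u w \<longleftrightarrow> x \<in> D u v \<union> D v w) \<and> \<not> (x \<in> D u v \<and> x \<in> D v w)"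
    using null[OF unit(1)] null[OF unit(2)] null[OF unit(3)] AE_space
  proof eventually_elim
    fix x assume x: "x \<notin> Z u" "x \<notin> Z v" "x \<notin> Z w" "x \<in> space ?U"
    then have nz: "dot I x u \<noteq> 0" "dot I x v \<noteq> 0" "dot I x w \<noteq> 0" by (auto simp: Z_def)
    from between have "(dot I x u * dot I x w < 0 \<longleftrightarrow> dot I x u * dot I x v < 0 \<or> dot I x v * dot I x w < 0)
        \<and> \<not> (dot I x u * dot I x v < 0 \<and> dot I x v * dot I x w < 0)"
    proof
      assume "\<forall>k\<in>I. w k = - u k"
      then have "dot I x w = - dot I x u" by (simp add: dot_def sum_negf)
      then show ?thesis using nz by (auto simp: mult_less_0_iff zero_less_mult_iff not_less)
    next
      assume "\<exists>a b. 0 \<le> a \<and> 0 \<le> b \<and> (\<forall>k\<in>I. v k = a * u k + b * w k)"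
      then obtain a b where ab: "0 \<le> a" "0 \<le> b" "\<And>k. k \<in> I \<Longrightarrow> v k = a * u k + b * w k" by blast
      have "dot I x v = dot I x (\<lambda>k. a * u k + b * w k)" by (intro dot_cong) (auto simp: ab)
      then have "dot I x v = a * dot I x u + b * dot I x w"
        by (simp only: dot_add_right dot_scale_right)
      then show ?thesis using nz ab(1,2)
        by (smt (verit) mult_less_0_iff mult_nonneg_nonneg mult_nonneg_nonpos)
    qed
    then show "(x \<in> D u w \<longleftrightarrow> x \<in> D u v \<union> D v w) \<and> \<not> (x \<in> D u v \<and> x \<in> D v w)"
      using x by (auto simp: D_def)
  qed
  then have "measure ?U (D u w) = measure ?U (D u v \<union> D v w)"
    by (intro finite_measure_eq_AE) (auto elim: eventually_mono)
  also have "\<dots> = measure ?U (D u v) + measure ?U (D v w)"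
    using AE by (intro measure_Un_AE) (auto simp: fmeasurable_eq_sets elim: eventually_mono)
  finally show ?thesis by (simp add: prob_separated_def D_def)
qed


text \<open>
  Additivity and nonnegativity make \<open>g\<close> monotone, so \<open>g t\<close> is squeezed between the values of \<open>g\<close> at
  consecutive multiples of \<open>L / n\<close>, which additivity determines.
\<close>
lemma additive_on_interval_linear:
  fixes g :: "real \<Rightarrow> real"
  assumes add: "\<And>s t. 0 \<le> s \<Longrightarrow> 0 \<le> t \<Longrightarrow> s + t \<le> L \<Longrightarrow> g (s + t) = g s + g t"
    and nonneg: "\<And>s. 0 \<le> g s" and t: "0 \<le> t" "t \<le> L" and "0 < L"
  shows "g t = g L * t / L"
proof -
  have mono: "g s \<le> g s'" if "0 \<le> s" "s \<le> s'" "s' \<le> L" for s s'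
    using add[of s "s' - s"] nonneg[of "s' - s"] that by simp
  have mult: "g (real k * s) = real k * g s" if "0 \<le> s" "real k * s \<le> L" for k s
    using that
  proof (induction k)
    case 0
    then show ?case using add[of 0 0] \<open>0 < L\<close> by simp
  next
    case (Suc k)
    then have "g (real k * s + s) = g (real k * s) + g s"
      by (intro add) (auto simp: algebra_simps)
    moreover have "real k * s \<le> L" using Suc.prems by (simp add: algebra_simps)
    ultimately show ?case using Suc by (simp add: algebra_simps)
  qed
  have part: "g (real j * (L / real n)) = real j * g L / real n" if "j \<le> n" "n > 0" for j n
  proof -
    have "real j * L \<le> real n * L" using that \<open>0 < L\<close> by (intro mult_right_mono) auto
    then have "g (real j * (L / real n)) = real j * g (L / real n)"
      using that \<open>0 < L\<close> by (intro mult) (auto simp: field_simps)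
    moreover have "g L = real n * g (L / real n)"
      using mult[of "L / real n" n] that \<open>0 < L\<close> by simp
    ultimately show ?thesis using that by simp
  qed
  have bound: "\<bar>g t - g L * t / L\<bar> \<le> g L / real n" if n: "n > 0" and "t < L" for n :: nat
  proof -
    define j where "j = nat \<lfloor>real n * t / L\<rfloor>"
    have "real j \<le> real n * t / L" "real n * t / L < real j + 1"
      using t \<open>0 < L\<close> by (auto simp: j_def)
    then have j: "real j * (L / real n) \<le> t" "t < real (Suc j) * (L / real n)"
      using n \<open>0 < L\<close> by (auto simp: field_simps)
    have "real n * t / L < real n" using \<open>t < L\<close> n \<open>0 < L\<close> by (simp add: divide_less_eq)
    with \<open>real j \<le> _\<close> have "real j < real n" by linarith
    then have "Suc j \<le> n" by simp
    have "real (Suc j) * (L / real n) \<le> L"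
      using mult_left_mono[of "real (Suc j)" "real n" L] \<open>Suc j \<le> n\<close> n \<open>0 < L\<close>
      by (simp add: field_simps)
    then have "real j * g L / real n \<le> g t" "g t \<le> real (Suc j) * g L / real n"
      using mono[of "real j * (L / real n)" t] mono[of t "real (Suc j) * (L / real n)"]
        part[of j n] part[of "Suc j" n] \<open>Suc j \<le> n\<close> n j t \<open>0 < L\<close> by auto
    moreover have "real j * g L / real n \<le> g L * t / L" "g L * t / L \<le> real (Suc j) * g L / real n"
      using mult_left_mono[OF j(1), of "g L / L"] mult_left_mono[OF less_imp_le[OF j(2)], of "g L / L"] nonneg[of L] \<open>0 < L\<close> n
      by (auto simp: field_simps)
    ultimately show ?thesis by (simp add: abs_le_iff add_divide_distrib distrib_right)
  qed
  show ?thesis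
  proof (cases "t = L")
    case True
    then show ?thesis using \<open>0 < L\<close> by simp
  next
    case False
    then have "t < L" using t by simp
    have "(\<lambda>n. g L / real n) \<longlonglongrightarrow> 0" by (rule lim_const_over_n)
    then have "\<bar>g t - g L * t / L\<bar> \<le> 0"
      by (rule LIMSEQ_le_const) (use bound \<open>t < L\<close> in \<open>auto intro!: exI[of _ 1]\<close>)
    then show ?thesis by simp
  qed
qed

text \<open>
  On a great half circle the probability of separation depends only on the angle, by orthogonal
  invariance, and is additive in it. Antipodal points are separated almost surely, so the
  probability is the fraction of the half turn.
\<close>
theorem prob_separated_eq_angle:
  assumes I: "finite I" "2 \<le> card I" and unit: "dot I u u = 1" "dot I w w = 1"
  shows "prob_separated I u w = arccos (dot I u w) / pi"
proof -
  obtain i j where ij: "i \<in> I" "j \<in> I" "i \<noteq> j"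
    using I by (metis card_le_Suc0_iff_eq not_less_eq_eq numeral_2_eq_2)
  define e where "e = (\<lambda>t k. if k = i then cos t else if k = j then sin t else 0 :: real)"
  have dot_e: "dot I x (e t) = x i * cos t + x j * sin t" for x t
  proof -
    have "dot I x (e t) = (\<Sum>k\<in>{i, j}. x k * e t k)"
      unfolding dot_def using ij I by (intro sum.mono_neutral_right) (auto simp: e_def)
    then show ?thesis using ij by (simp add: e_def)
  qed
  have ee: "dot I (e s) (e t) = cos (s - t)" for s t
    using ij by (simp add: dot_e cos_diff) (simp add: e_def)
  define g where "g = (\<lambda>t. prob_separated I (e 0) (e t))"
  have shift: "prob_separated I (e s) (e t) = g (t - s)" for s t
    unfolding g_def by (intro prob_separated_Gram I) (auto simp: ee cos_diff)
  have "I \<noteq> {}" using ij by auto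
  then interpret prob_space "uniform_ball I" using I by (intro prob_space_uniform_ball)
  have add: "g (s + t) = g s + g t" if st: "0 \<le> s" "0 \<le> t" "s + t \<le> pi" for s t
  proof -
    have "(\<forall>k\<in>I. e (s + t) k = - e 0 k) \<or>
      (\<exists>a b. 0 \<le> a \<and> 0 \<le> b \<and> (\<forall>k\<in>I. e s k = a * e 0 k + b * e (s + t) k))"
    proof (cases "s + t = pi \<or> s + t = 0")
      case True
      then show ?thesis
      proof
        assume "s + t = pi"
        then show ?thesis using ij by (simp add: e_def)
      next
        assume "s + t = 0"
        then have "s = 0" "t = 0" using st by auto
        then show ?thesis by (intro disjI2 exI[of _ 1] exI[of _ 0]) simp
      qed
    next
      case False
      then have pos: "0 < sin (s + t)" using st by (intro sin_gt_zero) auto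
      have id: "cos s * sin (s + t) = sin t + sin s * cos (s + t)"
      proof -
        have "sin t = sin (s + t - s)" by simp
        also have "\<dots> = sin (s + t) * cos s - cos (s + t) * sin s" by (rule sin_diff)
        finally show ?thesis by (simp add: mult.commute)
      qed
      then have "cos s = sin t / sin (s + t) + sin s / sin (s + t) * cos (s + t)"
        using pos by (simp add: field_simps)
      then have "e s k = sin t / sin (s + t) * e 0 k + sin s / sin (s + t) * e (s + t) k" for k
        using pos ij by (simp add: e_def)
      moreover have "0 \<le> sin t / sin (s + t)" "0 \<le> sin s / sin (s + t)"
        using st pos by (auto intro!: divide_nonneg_pos sin_ge_zero)
      ultimately show ?thesis by blast
    qed
    then have "prob_separated I (e 0) (e (s + t)) = prob_separated I (e 0) (e s) + prob_separated I (e s) (e (s + t))"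
      by (intro prob_separated_additive I) (auto simp: ee)
    then show ?thesis by (simp add: shift)
  qed
  have nonneg: "0 \<le> g s" for s by (simp add: g_def prob_separated_def)
  have "g pi = 1"
  proof -
    have e0: "dot I (e 0) (e 0) = 1" by (simp add: ee)
    have "AE x in uniform_ball I. x \<notin> {x \<in> space (lebesgue_on_coords I). dot I x (e 0) = 0}"
      using prob_hyperplane_eq_0[OF I(1) e0]
      by (intro AE_not_in null_setsI) (auto simp: emeasure_eq_measure)
    then have "AE x in uniform_ball I. x \<in> {x \<in> space (lebesgue_on_coords I). dot I x (e 0) * dot I x (e pi) < 0}"
      using AE_space by eventually_elim (auto simp: dot_e zero_less_mult_iff)
    then show ?thesis unfolding g_def prob_separated_def by (rule prob_eq_1[THEN iffD2, rotated]) simp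
  qed
  have "\<bar>dot I u w\<bar> \<le> 1"
    using dot_le_norms[of I u w] unit by (simp add: L2_set_dot)
  then have ac: "0 \<le> arccos (dot I u w)" "arccos (dot I u w) \<le> pi" "cos (arccos (dot I u w)) = dot I u w"
    by (auto intro: arccos_lbound arccos_ubound simp: abs_le_iff)
  have "prob_separated I u w = g (arccos (dot I u w))"
    unfolding g_def using I unit ac by (intro prob_separated_Gram) (auto simp: ee)
  also have "\<dots> = arccos (dot I u w) / pi"
    using additive_on_interval_linear[of pi g, OF add nonneg ac(1,2)] \<open>g pi = 1\<close> by simp
  finally show ?thesis .
qed

section \<open>Counting zeros through short intervals\<close>

text \<open>
  By compactness a zero exists iff \<open>\<bar>F x\<bar>\<close> takes arbitrarily small values on a countable dense subset
  of \<open>K\<close>; the latter is a countable condition on \<open>x\<close>.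
\<close>
lemma sets_has_zero_compact:
  fixes F :: "'a \<Rightarrow> 'b :: euclidean_space \<Rightarrow> real"
  assumes meas: "\<And>t. (\<lambda>x. F x t) \<in> borel_measurable M"
    and cont: "\<And>x. x \<in> space M \<Longrightarrow> continuous_on K (F x)" and K: "compact K"
  shows "{x \<in> space M. \<exists>t\<in>K. F x t = 0} \<in> sets M"
proof -
  obtain D where D: "countable D" "D \<subseteq> K" "K \<subseteq> closure D" by (rule separable)
  have "{x \<in> space M. \<exists>t\<in>K. F x t = 0} = {x \<in> space M. \<forall>n::nat. \<exists>t\<in>D. \<bar>F x t\<bar> < 1 / Suc n}"
  proof (intro Collect_cong conj_cong refl iffI allI)
    fix x n assume x: "x \<in> space M" and "\<exists>t\<in>K. F x t = 0"
    then obtain t where t: "t \<in> K" "F x t = 0" by blast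
    obtain d where d: "d > 0" "\<And>s. s \<in> K \<Longrightarrow> dist s t < d \<Longrightarrow> dist (F x s) (F x t) < 1 / Suc n"
      using cont[OF x] t(1) unfolding continuous_on_iff
      by (metis of_nat_0_less_iff zero_less_Suc zero_less_divide_1_iff)
    obtain s where "s \<in> D" "dist s t < d"
      using D(3) t(1) d(1) by (meson closure_approachable subsetD)
    then show "\<exists>t\<in>D. \<bar>F x t\<bar> < 1 / Suc n"
      using d(2)[of s] D(2) t(2) by (auto intro!: bexI[of _ s])
  next
    fix x assume x: "x \<in> space M" and small: "\<forall>n::nat. \<exists>t\<in>D. \<bar>F x t\<bar> < 1 / Suc n"
    have "K \<noteq> {}" using small D(2) by blast
    then obtain t where t: "t \<in> K" "\<And>s. s \<in> K \<Longrightarrow> \<bar>F x t\<bar> \<le> \<bar>F x s\<bar>"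
      using continuous_attains_inf[OF K, of "\<lambda>t. \<bar>F x t\<bar>"] cont[OF x]
      by (auto intro: continuous_on_rabs)
    have "F x t = 0"
    proof (rule ccontr)
      assume "F x t \<noteq> 0"
      then obtain n :: nat where "1 / Suc n < \<bar>F x t\<bar>"
        using reals_Archimedean[of "\<bar>F x t\<bar>"] by (auto simp: inverse_eq_divide)
      moreover obtain s where "s \<in> D" "\<bar>F x s\<bar> < 1 / Suc n" using small by blast
      ultimately show False using t(2)[of s] D(2) by force
    qed
    with t(1) show "\<exists>t\<in>K. F x t = 0" by blast
  qed
  also have "\<dots> = space M \<inter> (\<Inter>n::nat. \<Union>t\<in>D. {x \<in> space M. \<bar>F x t\<bar> < 1 / Suc n})" by auto
  also have "\<dots> \<in> sets M"
  proof -
    have small: "{x \<in> space M. \<bar>F x t\<bar> < 1 / Suc n} \<in> sets M" for t n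
      using meas[of t] by measurable
    have "(\<Union>t\<in>D. {x \<in> space M. \<bar>F x t\<bar> < 1 / Suc n}) \<in> sets M" for n :: nat
      by (rule sets.countable_UN''[OF D(1) small])
    then have "(\<Inter>n::nat. \<Union>t\<in>D. {x \<in> space M. \<bar>F x t\<bar> < 1 / Suc n}) \<in> sets M"
      by (intro sets.countable_INT) (auto simp del: of_nat_Suc)
    then show ?thesis by (intro sets.Int sets.top)
  qed
  finally show ?thesis .
qed

lemma sets_has_zero_Ico:
  fixes F :: "'a \<Rightarrow> real \<Rightarrow> real"
  assumes meas: "\<And>t. (\<lambda>x. F x t) \<in> borel_measurable M"
    and cont: "\<And>x. x \<in> space M \<Longrightarrow> continuous_on UNIV (F x)"
  shows "{x \<in> space M. \<exists>t\<in>{a..<b}. F x t = 0} \<in> sets M"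
proof -
  have "{x \<in> space M. \<exists>t\<in>{a..<b}. F x t = 0} = (\<Union>n. {x \<in> space M. \<exists>t\<in>{a..b - 1 / Suc n}. F x t = 0})"
  proof safe
    fix x t assume x: "x \<in> space M" "F x t = 0" "t \<in> {a..<b}"
    then obtain n :: nat where "1 / Suc n < b - t"
      using reals_Archimedean[of "b - t"] by (auto simp: inverse_eq_divide)
    then show "x \<in> (\<Union>n. {x \<in> space M. \<exists>t\<in>{a..b - 1 / Suc n}. F x t = 0})"
      using x by (auto intro!: exI[of _ n] bexI[of _ t])
  next
    fix x n t assume "t \<in> {a..b - 1 / real (Suc n)}" "F x t = 0"
    moreover have "b - 1 / real (Suc n) < b" by simp
    ultimately show "\<exists>t\<in>{a..<b}. F x t = 0"
      by (metis atLeastAtMost_iff atLeastLessThan_iff order_le_less_trans)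
  qed
  also have "\<dots> \<in> sets M"
    using meas cont by (intro sets.countable_UN'' sets_has_zero_compact) (auto intro: continuous_on_subset)
  finally show ?thesis .
qed

definition cell :: "real \<Rightarrow> nat \<Rightarrow> nat \<Rightarrow> real set" where
  "cell T n j = {real j * (T / real n)..<real (Suc j) * (T / real n)}"

lemma in_cell_iff:
  assumes "0 < T" "0 < n" "0 \<le> t"
  shows "t \<in> cell T n j \<longleftrightarrow> j = nat \<lfloor>t / (T / real n)\<rfloor>"
proof -
  have "0 < T / real n" using assms by simp
  then have "t \<in> cell T n j \<longleftrightarrow> real j \<le> t / (T / real n) \<and> t / (T / real n) < real j + 1"
    unfolding cell_def by (simp only: pos_le_divide_eq pos_divide_less_eq) (simp add: add.commute)
  also have "\<dots> \<longleftrightarrow> \<lfloor>t / (T / real n)\<rfloor> = int j"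
    by (simp add: floor_eq_iff)
  also have "\<dots> \<longleftrightarrow> j = nat \<lfloor>t / (T / real n)\<rfloor>"
  proof -
    have "0 \<le> t / (T / real n)" using \<open>0 \<le> t\<close> \<open>0 < T / real n\<close> by (intro divide_nonneg_pos)
    then have "0 \<le> \<lfloor>t / (T / real n)\<rfloor>" by simp
    then show ?thesis by linarith
  qed
  finally show ?thesis .
qed

definition cells_hit :: "real \<Rightarrow> nat \<Rightarrow> real set \<Rightarrow> nat" where
  "cells_hit T n Z = card {j \<in> {..<n}. Z \<inter> cell T n j \<noteq> {}}"

lemma cells_hit_le_count:
  assumes Z: "Z \<subseteq> {0..<T}" and "0 < T"
  shows "of_nat (cells_hit T n Z) \<le> emeasure (count_space UNIV) Z"
proof (cases "n = 0")
  case False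
  define H where "H = {j \<in> {..<n}. Z \<inter> cell T n j \<noteq> {}}"
  define p where "p = (\<lambda>j. SOME t. t \<in> Z \<inter> cell T n j)"
  have p: "p j \<in> Z" "p j \<in> cell T n j" if "j \<in> H" for j
    using someI_ex[of "\<lambda>t. t \<in> Z \<inter> cell T n j"] that by (auto simp: H_def p_def)
  have "inj_on p H"
  proof (rule inj_onI)
    fix j k assume "j \<in> H" "k \<in> H" "p j = p k"
    moreover have "0 \<le> p j" using p(1)[OF \<open>j \<in> H\<close>] Z by auto
    ultimately show "j = k"
      using p(2)[of j] p(2)[of k] False \<open>0 < T\<close> by (simp add: in_cell_iff)
  qed
  then have "of_nat (cells_hit T n Z) = (of_nat (card (p ` H)) :: ennreal)"
    by (simp add: card_image cells_hit_def H_def)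
  also have "\<dots> = emeasure (count_space UNIV) (p ` H)"
    by (subst emeasure_count_space_finite) (auto simp: H_def)
  also have "\<dots> \<le> emeasure (count_space UNIV) Z"
    using p by (intro emeasure_mono) auto
  finally show ?thesis .
qed (simp add: cells_hit_def)

text \<open>
  Cells shorter than the distance between any two distinct points of \<open>F\<close> contain at most one of them.
\<close>
lemma eventually_card_le_cells_hit:
  assumes F: "finite F" "F \<subseteq> Z" and Z: "Z \<subseteq> {0..<T}" and "0 < T"
  shows "eventually (\<lambda>n. card F \<le> cells_hit T n Z) sequentially"
proof -
  have "eventually (\<lambda>n. \<forall>p\<in>{(s, t) \<in> F \<times> F. s \<noteq> t}. T / real n < \<bar>fst p - snd p\<bar>) sequentially"
  proof (rule eventually_ball_finite)
    show "finite {(s, t) \<in> F \<times> F. s \<noteq> t}" using F(1) by (intro finite_subset[OF _ finite_cartesian_product[of F F]]) auto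
    show "\<forall>p\<in>{(s, t) \<in> F \<times> F. s \<noteq> t}. eventually (\<lambda>n. T / real n < \<bar>fst p - snd p\<bar>) sequentially"
      using order_tendstoD(2)[OF lim_const_over_n[of T]] by auto
  qed
  then show ?thesis using eventually_gt_at_top[of 0]
  proof eventually_elim
    fix n :: nat assume sep: "\<forall>p\<in>{(s, t) \<in> F \<times> F. s \<noteq> t}. T / real n < \<bar>fst p - snd p\<bar>" and n: "0 < n"
    define j where "j = (\<lambda>t. nat \<lfloor>t / (T / real n)\<rfloor>)"
    have jc: "t \<in> cell T n (j t)" if "t \<in> F" for t
      using in_cell_iff[of T n t "j t"] that F Z n \<open>0 < T\<close> by (force simp: j_def)
    have jn: "j t < n" if "t \<in> F" for t
    proof -
      have "real (j t) * (T / real n) < real n * (T / real n)"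
        using jc[OF that] that F Z n by (force simp: cell_def)
      moreover have "0 < T / real n" using \<open>0 < T\<close> n by simp
      ultimately show ?thesis by (simp only: mult_less_cancel_right_pos of_nat_less_iff)
    qed
    have "inj_on j F"
    proof (rule inj_onI, rule ccontr)
      fix s t assume st: "s \<in> F" "t \<in> F" "j s = j t" "s \<noteq> t"
      then have "\<bar>s - t\<bar> < T / real n"
        using jc[of s] jc[of t] by (auto simp: cell_def algebra_simps abs_less_iff)
      moreover have "T / real n < \<bar>s - t\<bar>" using sep st by auto
      ultimately show False by simp
    qed
    then have "card F = card (j ` F)" by (simp add: card_image)
    also have "\<dots> \<le> cells_hit T n Z"
      unfolding cells_hit_def using jc jn F by (intro card_mono) (auto)
    finally show "card F \<le> cells_hit T n Z" .
  qed
qed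

text \<open>
  This expresses the number of zeros, even an infinite one, through the events ``there is a zero in
  this interval'', whose probabilities can be estimated one by one.
\<close>
lemma count_eq_liminf_cells_hit:
  assumes Z: "Z \<subseteq> {0..<T}" and "0 < T"
  shows "emeasure (count_space UNIV) Z = liminf (\<lambda>n. of_nat (cells_hit T n Z))"
proof (rule antisym)
  have card_le: "of_nat (card F) \<le> liminf (\<lambda>n. of_nat (cells_hit T n Z) :: ennreal)"
    if "finite F" "F \<subseteq> Z" for F
    using eventually_card_le_cells_hit[OF that assms]
    by (intro Liminf_bounded) (auto elim: eventually_mono)
  show "emeasure (count_space UNIV) Z \<le> liminf (\<lambda>n. of_nat (cells_hit T n Z))"
  proof (cases "finite Z")
    case True
    then show ?thesis using card_le[of Z] by (simp add: emeasure_count_space_finite)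
  next
    case False
    have "of_nat k \<le> liminf (\<lambda>n. of_nat (cells_hit T n Z) :: ennreal)" for k
      using infinite_arbitrarily_large[OF False, of k] card_le by blast
    then have "(SUP k. of_nat k) \<le> liminf (\<lambda>n. of_nat (cells_hit T n Z) :: ennreal)"
      by (intro SUP_least)
    then show ?thesis by (simp add: ennreal_SUP_of_nat_eq_top top_unique)
  qed
  have "liminf (\<lambda>n. of_nat (cells_hit T n Z) :: ennreal) \<le> limsup (\<lambda>n. of_nat (cells_hit T n Z))"
    by (rule Liminf_le_Limsup) simp
  also have "\<dots> \<le> emeasure (count_space UNIV) Z"
    by (rule Limsup_bounded) (simp add: cells_hit_le_count[OF assms])
  finally show "liminf (\<lambda>n. of_nat (cells_hit T n Z)) \<le> emeasure (count_space UNIV) Z" .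
qed

text \<open>
  The function falls from \<open>f a > 0\<close> to its zero and then does not end below it, so \<open>f'\<close> is
  negative somewhere and nonnegative later. Hence \<open>f'\<close> is of size \<open>B (b - a)\<close> where it is negative, and
  \<open>f a\<close> is at most \<open>b - a\<close> times as large.
\<close>
lemma zero_without_sign_change_aux:
  fixes f f' f'' :: "real \<Rightarrow> real"
  assumes d1: "\<And>t. (f has_real_derivative f' t) (at t)" and d2: "\<And>t. (f' has_real_derivative f'' t) (at t)"
    and bound: "\<And>t. \<bar>f'' t\<bar> \<le> B" and z: "a \<le> z" "z < b" "f z = 0" and "0 < f a" "0 \<le> f b"
  shows "f a \<le> B * (b - a)\<^sup>2"
proof -
  have "a < z" using z \<open>0 < f a\<close> by (cases "a = z") auto
  obtain p where p: "a < p" "p < z" "f z - f a = (z - a) * f' p"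
    using MVT2[OF \<open>a < z\<close>, of f f'] d1 by blast
  obtain q where q: "z < q" "q < b" "f b - f z = (b - z) * f' q"
    using MVT2[OF z(2), of f f'] d1 by blast
  obtain r where r: "f' q - f' p = (q - p) * f'' r"
    using MVT2[of p q f' f''] d2 p q by (meson less_trans)
  have "0 \<le> f' q" using q z \<open>0 \<le> f b\<close> by (simp add: zero_le_mult_iff)
  have "(q - p) * f'' r \<le> (q - p) * B"
    using bound[of r] p q by (intro mult_left_mono) auto
  also have "\<dots> \<le> (b - a) * B"
    using bound[of 0] p q z by (intro mult_right_mono) auto
  finally have "(q - p) * f'' r \<le> (b - a) * B" .
  then have "- f' p \<le> (b - a) * B" using r \<open>0 \<le> f' q\<close> by linarith
  moreover have "0 \<le> (b - a) * B" using bound[of 0] z by (intro mult_nonneg_nonneg) auto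
  ultimately have "(z - a) * (- f' p) \<le> (b - a) * ((b - a) * B)"
    using z \<open>a < z\<close> by (metis diff_ge_0_iff_ge diff_right_mono less_imp_le mult_left_mono mult_right_mono order_trans)
  then show ?thesis using p z by (simp add: power2_eq_square algebra_simps)
qed

lemma zero_without_sign_change:
  fixes f f' f'' :: "real \<Rightarrow> real"
  assumes d1: "\<And>t. (f has_real_derivative f' t) (at t)" and d2: "\<And>t. (f' has_real_derivative f'' t) (at t)"
    and bound: "\<And>t. \<bar>f'' t\<bar> \<le> B" and z: "a \<le> z" "z < b" "f z = 0" and nonsep: "\<not> f a * f b < 0"
  shows "\<bar>f a\<bar> \<le> B * (b - a)\<^sup>2"
proof -
  consider "f a = 0" | "0 < f a" "0 \<le> f b" | "f a < 0" "f b \<le> 0"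
    using nonsep by (force simp: mult_less_0_iff not_less)
  then show ?thesis
  proof cases
    case 1
    have "0 \<le> B" using bound[of 0] by linarith
    then show ?thesis using 1 by simp
  next
    case 2
    then show ?thesis using zero_without_sign_change_aux[OF d1 d2 bound z] by simp
  next
    case 3
    have "- f a \<le> B * (b - a)\<^sup>2"
    proof (rule zero_without_sign_change_aux[where f = "\<lambda>t. - f t" and f' = "\<lambda>t. - f' t" and f'' = "\<lambda>t. - f'' t" and z = z])
    qed (use d1 d2 bound z 3 in \<open>auto intro: DERIV_minus\<close>)
    then show ?thesis using 3 by simp
  qed
qed

text \<open>
  The values are extended reals and not cardinalities, which would turn infinitely many zeros into
  none and break the limit formula below.
\<close>
definition count_zeros :: "real \<Rightarrow> (real \<Rightarrow> real) \<Rightarrow> ennreal" where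
  "count_zeros T f = emeasure (count_space UNIV) {t \<in> {0..<T}. f t = 0}"

lemma cells_hit_zeros:
  assumes "0 < T" "x \<in> S"
  shows "(of_nat (cells_hit T n {t \<in> {0..<T}. F x t = 0}) :: ennreal)
    = (\<Sum>j<n. indicator {x \<in> S. \<exists>t\<in>cell T n j. F x t = 0} x)"
proof -
  have "cell T n j \<subseteq> {0..<T}" if "j < n" for j
  proof -
    have "real (Suc j) * (T / real n) \<le> real n * (T / real n)"
      using that \<open>0 < T\<close> by (intro mult_right_mono) auto
    then have "real (Suc j) * (T / real n) \<le> T" using that by simp
    moreover have "0 \<le> real j * (T / real n)" using \<open>0 < T\<close> by simp
    ultimately show ?thesis unfolding cell_def by (intro ivl_subset[THEN iffD2] disjI2 conjI)
  qed
  then have "{j \<in> {..<n}. {t \<in> {0..<T}. F x t = 0} \<inter> cell T n j \<noteq> {}} = {j \<in> {..<n}. \<exists>t\<in>cell T n j. F x t = 0}"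
    by blast
  then show ?thesis using assms
    by (simp add: cells_hit_def indicator_def of_bool_def sum.If_cases Int_def)
qed

lemma count_zeros_eq_liminf:
  assumes "0 < T" "x \<in> S"
  shows "count_zeros T (F x) = liminf (\<lambda>n. \<Sum>j<n. indicator {x \<in> S. \<exists>t\<in>cell T n j. F x t = 0} x)"
  unfolding count_zeros_def cells_hit_zeros[OF assms, symmetric]
  by (rule count_eq_liminf_cells_hit) (use assms in auto)

lemma borel_measurable_count_zeros:
  fixes F :: "'a \<Rightarrow> real \<Rightarrow> real"
  assumes "0 < T" and meas: "\<And>t. (\<lambda>x. F x t) \<in> borel_measurable M"
    and cont: "\<And>x. x \<in> space M \<Longrightarrow> continuous_on UNIV (F x)"
  shows "(\<lambda>x. count_zeros T (F x)) \<in> borel_measurable M"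
proof -
  have "{x \<in> space M. \<exists>t\<in>cell T n j. F x t = 0} \<in> sets M" for n j
    unfolding cell_def using meas cont by (rule sets_has_zero_Ico)
  then have "(\<lambda>x. liminf (\<lambda>n. \<Sum>j<n. indicator {x \<in> space M. \<exists>t\<in>cell T n j. F x t = 0} x :: ennreal))
      \<in> borel_measurable M"
    by (intro borel_measurable_liminf borel_measurable_sum borel_measurable_indicator)
  then show ?thesis
    using count_zeros_eq_liminf[OF \<open>0 < T\<close>, of _ "space M" F] by (simp cong: measurable_cong)
qed

lemma continuous_on_dot:
  fixes c :: "real \<Rightarrow> 'i \<Rightarrow> real"
  shows "(\<And>k. k \<in> I \<Longrightarrow> continuous_on S (\<lambda>t. c t k)) \<Longrightarrow> continuous_on S (\<lambda>t. dot I x (c t))"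
  unfolding dot_def by (intro continuous_intros)

lemma has_real_derivative_dot:
  fixes c c' :: "real \<Rightarrow> 'i \<Rightarrow> real"
  assumes "\<And>k. k \<in> I \<Longrightarrow> ((\<lambda>t. c t k) has_real_derivative c' t k) (at t)"
  shows "((\<lambda>t. dot I x (c t)) has_real_derivative dot I x (c' t)) (at t)"
  unfolding dot_def by (intro DERIV_sum DERIV_cmult assms)

section \<open>Expected number of zeros of a random linear combination\<close>

text \<open>
  A sign change forces a zero. Conversely, if there is a zero without a sign change, then the value
  at \<open>a\<close> is of the second order in \<open>b - a\<close>, so \<open>x\<close> lies in a slab whose probability is of this order.
\<close>
lemma prob_zero_in_interval:
  fixes c c' c'' :: "real \<Rightarrow> 'i \<Rightarrow> real"
  assumes I: "finite I" "2 \<le> card I"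
    and d1: "\<And>k t. k \<in> I \<Longrightarrow> ((\<lambda>t. c t k) has_real_derivative c' t k) (at t)"
    and d2: "\<And>k t. k \<in> I \<Longrightarrow> ((\<lambda>t. c' t k) has_real_derivative c'' t k) (at t)"
    and bound: "\<And>t. L2_set (c'' t) I \<le> B"
    and unit: "\<And>t. dot I (c t) (c t) = 1"
  obtains C where "\<And>a b. a \<le> b \<Longrightarrow>
    measure (uniform_ball I) {x \<in> space (lebesgue_on_coords I). \<exists>t\<in>{a..<b}. dot I x (c t) = 0}
      \<in> {arccos (dot I (c a) (c b)) / pi .. arccos (dot I (c a) (c b)) / pi + C * (b - a)\<^sup>2}"
proof -
  let ?P = "lebesgue_on_coords I" and ?U = "uniform_ball I"
  have "I \<noteq> {}" using I by auto
  interpret prob_space ?U using I(1) \<open>I \<noteq> {}\<close> by (rule prob_space_uniform_ball)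
  obtain C where C: "0 \<le> C" "\<And>u \<epsilon>. dot I u u = 1 \<Longrightarrow> \<epsilon> \<ge> 0 \<Longrightarrow>
    measure ?U {x \<in> space ?P. \<bar>dot I x u\<bar> \<le> \<epsilon>} \<le> C * \<epsilon>"
    by (rule prob_slab_le[OF I(1) \<open>I \<noteq> {}\<close>]) blast
  have "0 \<le> B" using bound[of 0] L2_set_nonneg[of "c'' 0" I] by linarith
  define f where "f = (\<lambda>x t. dot I x (c t))"
  have f1: "(f x has_real_derivative dot I x (c' t)) (at t)" for x t
    unfolding f_def by (intro has_real_derivative_dot d1)
  have f2: "((\<lambda>t. dot I x (c' t)) has_real_derivative dot I x (c'' t)) (at t)" for x t
    by (intro has_real_derivative_dot d2)
  have cont: "continuous_on S (f x)" for x S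
    by (intro continuous_at_imp_continuous_on ballI DERIV_isCont[OF f1])
  have f_meas [measurable]: "(\<lambda>x. f x t) \<in> borel_measurable ?P" for t
    unfolding f_def by measurable
  show thesis
  proof (rule that[of "C * B"])
    fix a b :: real assume "a \<le> b"
    define Z where "Z = {x \<in> space ?P. \<exists>t\<in>{a..<b}. f x t = 0}"
    define D where "D = {x \<in> space ?P. f x a * f x b < 0}"
    define N where "N = {x \<in> space ?P. \<bar>f x a\<bar> \<le> B * (b - a)\<^sup>2}"
    have [measurable]: "Z \<in> sets ?P" unfolding Z_def using f_meas cont by (rule sets_has_zero_Ico)
    have [measurable]: "D \<in> sets ?P" "N \<in> sets ?P" unfolding D_def N_def by measurable
    have PD: "measure ?U D = arccos (dot I (c a) (c b)) / pi"
      using prob_separated_eq_angle[OF I unit unit] by (simp add: prob_separated_def D_def f_def)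
    have PN: "measure ?U N \<le> C * B * (b - a)\<^sup>2"
      using C(2)[OF unit, of "B * (b - a)\<^sup>2" a] \<open>0 \<le> B\<close> by (simp add: N_def f_def mult.assoc)
    have "D \<subseteq> Z"
    proof
      fix x assume x: "x \<in> D"
      then have "\<exists>t. a \<le> t \<and> t \<le> b \<and> f x t = 0"
        using IVT'[of "f x" a 0 b] IVT2'[of "f x" b 0 a] \<open>a \<le> b\<close> cont
        by (auto simp: D_def mult_less_0_iff)
      then obtain t where "a \<le> t" "t \<le> b" "f x t = 0" by blast
      moreover from this have "t \<noteq> b" using x by (auto simp: D_def)
      ultimately show "x \<in> Z" using x by (auto simp: Z_def D_def intro!: bexI[of _ t])
    qed
    then have "measure ?U D \<le> measure ?U Z" by (intro finite_measure_mono) auto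
    moreover have "measure ?U Z \<le> measure ?U (D \<union> N)"
    proof (rule finite_measure_mono_AE)
      show "AE x in ?U. x \<in> Z \<longrightarrow> x \<in> D \<union> N"
        unfolding uniform_ball_def
      proof (intro AE_uniform_measureI AE_I2 impI)
        fix x assume x: "x \<in> punctured_unit_ball I" "x \<in> Z"
        then obtain t where t: "a \<le> t" "t < b" "f x t = 0" by (auto simp: Z_def)
        have "\<bar>dot I x (c'' s)\<bar> \<le> B" for s
        proof -
          have "\<bar>dot I x (c'' s)\<bar> \<le> L2_set x I * L2_set (c'' s) I" by (rule dot_le_norms)
          also have "\<dots> \<le> 1 * B"
            using x bound[of s] by (intro mult_mono) (auto simp: L2_set_dot punctured_unit_ball_def dot_self_nonneg)
          finally show ?thesis by simp
        qed
        then have "\<bar>f x a\<bar> \<le> B * (b - a)\<^sup>2" if "\<not> f x a * f x b < 0"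
          using zero_without_sign_change[OF f1 f2 _ t that] by blast
        then show "x \<in> D \<union> N" using x by (auto simp: D_def N_def Z_def)
      qed simp
    qed auto
    moreover have "measure ?U (D \<union> N) \<le> measure ?U D + measure ?U N"
      by (rule measure_Un_le) auto
    ultimately show "measure ?U {x \<in> space ?P. \<exists>t\<in>{a..<b}. dot I x (c t) = 0}
      \<in> {arccos (dot I (c a) (c b)) / pi .. arccos (dot I (c a) (c b)) / pi + C * B * (b - a)\<^sup>2}"
      using PD PN by (simp add: Z_def f_def)
  qed
qed

text \<open>
  With \<open>n\<close> cells the expected number of cells that contain a zero is \<open>n \<cdot> arccos (\<kappa> (T / n)) / \<pi>\<close>, up
  to an error \<open>n \<cdot> O (1 / n\<^sup>2)\<close>. This tends to \<open>T \<sigma> / \<pi>\<close>, where \<open>\<sigma>\<close> is the angular speed of the curve.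
  The number of cells hit never exceeds the number of zeros, which is also its limit inferior, so
  Fatou's lemma and monotonicity give both inequalities.
\<close>
theorem expected_count_zeros:
  fixes c c' c'' :: "real \<Rightarrow> 'i \<Rightarrow> real"
  assumes I: "finite I" "2 \<le> card I"
    and d1: "\<And>k t. k \<in> I \<Longrightarrow> ((\<lambda>t. c t k) has_real_derivative c' t k) (at t)"
    and d2: "\<And>k t. k \<in> I \<Longrightarrow> ((\<lambda>t. c' t k) has_real_derivative c'' t k) (at t)"
    and bound: "\<And>t. L2_set (c'' t) I \<le> B"
    and stationary: "\<And>s t. dot I (c s) (c t) = \<kappa> (t - s)" and unit: "\<kappa> 0 = 1"
    and speed: "((\<lambda>h. arccos (\<kappa> h) / h) \<longlongrightarrow> \<sigma>) (at_right 0)"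
    and "0 < T"
  shows "(\<integral>\<^sup>+x. count_zeros T (\<lambda>t. dot I x (c t)) \<partial>uniform_ball I) = ennreal (T * \<sigma> / pi)"
proof -
  let ?P = "lebesgue_on_coords I" and ?U = "uniform_ball I"
  have "I \<noteq> {}" using I by auto
  interpret prob_space ?U using I(1) \<open>I \<noteq> {}\<close> by (rule prob_space_uniform_ball)
  define F where "F = (\<lambda>x t. dot I x (c t))"
  have cont: "continuous_on UNIV (F x)" for x
    unfolding F_def
    by (intro continuous_on_dot continuous_at_imp_continuous_on ballI) (rule DERIV_isCont[OF d1])
  have F_meas: "(\<lambda>x. F x t) \<in> borel_measurable ?P" for t unfolding F_def by measurable
  define A where "A = (\<lambda>n j. {x \<in> space ?P. \<exists>t\<in>cell T n j. F x t = 0})"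
  have [measurable]: "A n j \<in> sets ?P" for n j
    unfolding A_def cell_def using F_meas cont by (rule sets_has_zero_Ico)
  define m where "m = (\<lambda>n. \<Sum>j<n. measure ?U (A n j))"
  have m: "(\<integral>\<^sup>+x. (\<Sum>j<n. indicator (A n j) x) \<partial>?U) = ennreal (m n)" for n
    unfolding m_def by (simp add: nn_integral_sum emeasure_eq_measure sum_ennreal)
  obtain C where C: "\<And>a b. a \<le> b \<Longrightarrow>
    measure ?U {x \<in> space ?P. \<exists>t\<in>{a..<b}. dot I x (c t) = 0}
      \<in> {arccos (dot I (c a) (c b)) / pi .. arccos (dot I (c a) (c b)) / pi + C * (b - a)\<^sup>2}"
    by (rule prob_zero_in_interval[OF I d1 d2 bound]) (use stationary unit in auto)
  define p where "p = (\<lambda>n :: nat. arccos (\<kappa> (T / real n)) / pi)"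
  have PA: "p n \<le> measure ?U (A n j)" "measure ?U (A n j) \<le> p n + C * (T / real n)\<^sup>2" for n j
  proof -
    have "real (Suc j) * (T / real n) - real j * (T / real n) = T / real n"
      by (simp add: algebra_simps add_divide_distrib)
    moreover have "real j * (T / real n) \<le> real (Suc j) * (T / real n)"
      using \<open>0 < T\<close> by (intro mult_right_mono) auto
    ultimately show "p n \<le> measure ?U (A n j)" "measure ?U (A n j) \<le> p n + C * (T / real n)\<^sup>2"
      using C[of "real j * (T / real n)" "real (Suc j) * (T / real n)"]
      by (simp_all only: A_def cell_def F_def p_def stationary atLeastAtMost_iff)
  qed
  have lim_h: "filterlim (\<lambda>n. T / real n) (at_right 0) sequentially"
    unfolding filterlim_at using lim_const_over_n[of T] \<open>0 < T\<close>
    by (auto intro: eventually_mono[OF eventually_gt_at_top[of 0]])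
  have "(\<lambda>n. arccos (\<kappa> (T / real n)) / (T / real n)) \<longlonglongrightarrow> \<sigma>"
    by (rule filterlim_compose[OF speed lim_h])
  then have "(\<lambda>n. T / pi * (arccos (\<kappa> (T / real n)) / (T / real n))) \<longlonglongrightarrow> T / pi * \<sigma>"
    by (rule tendsto_mult_left)
  then have np: "(\<lambda>n. real n * p n) \<longlonglongrightarrow> T * \<sigma> / pi"
    using \<open>0 < T\<close> by (simp add: p_def mult_ac)
  have "(\<lambda>n. C * T\<^sup>2 / real n) \<longlonglongrightarrow> 0" by (rule lim_const_over_n)
  from tendsto_add[OF np this]
  have np': "(\<lambda>n. real n * p n + C * T\<^sup>2 / real n) \<longlonglongrightarrow> T * \<sigma> / pi" by simp
  have "m \<longlonglongrightarrow> T * \<sigma> / pi"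
  proof (rule tendsto_sandwich[OF _ _ np np'])
    show "\<forall>\<^sub>F n in sequentially. real n * p n \<le> m n"
      unfolding m_def using sum_mono[of "{..<n}" "\<lambda>_. p n" "\<lambda>j. measure ?U (A n j)" for n] PA(1)
      by (intro always_eventually) auto
    show "\<forall>\<^sub>F n in sequentially. m n \<le> real n * p n + C * T\<^sup>2 / real n"
    proof (intro always_eventually allI)
      fix n
      have "m n \<le> (\<Sum>j<n. p n + C * (T / real n)\<^sup>2)"
        unfolding m_def using PA(2) by (intro sum_mono)
      also have "\<dots> = real n * p n + C * T\<^sup>2 / real n"
        by (simp add: distrib_left power2_eq_square)
      finally show "m n \<le> real n * p n + C * T\<^sup>2 / real n" .
    qed
  qed
  then have lim: "(\<lambda>n. ennreal (m n)) \<longlonglongrightarrow> ennreal (T * \<sigma> / pi)"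
    by (rule tendsto_ennrealI)
  have "(\<integral>\<^sup>+x. count_zeros T (F x) \<partial>?U) = (\<integral>\<^sup>+x. liminf (\<lambda>n. \<Sum>j<n. indicator (A n j) x) \<partial>?U)"
    unfolding A_def by (intro nn_integral_cong count_zeros_eq_liminf) (use \<open>0 < T\<close> in auto)
  also have "\<dots> \<le> liminf (\<lambda>n. \<integral>\<^sup>+x. (\<Sum>j<n. indicator (A n j) x) \<partial>?U)"
    by (rule nn_integral_liminf) measurable
  also have "\<dots> = ennreal (T * \<sigma> / pi)"
    unfolding m using lim by (intro lim_imp_Liminf) auto
  finally have upper: "(\<integral>\<^sup>+x. count_zeros T (F x) \<partial>?U) \<le> ennreal (T * \<sigma> / pi)" .
  have "ennreal (m n) \<le> (\<integral>\<^sup>+x. count_zeros T (F x) \<partial>?U)" for n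
    unfolding m[symmetric] count_zeros_def
  proof (rule nn_integral_mono)
    fix x assume "x \<in> space ?U"
    then have "(\<Sum>j<n. indicator (A n j) x) = (of_nat (cells_hit T n {t \<in> {0..<T}. F x t = 0}) :: ennreal)"
      unfolding A_def using \<open>0 < T\<close> by (intro cells_hit_zeros[symmetric]) auto
    also have "\<dots> \<le> emeasure (count_space UNIV) {t \<in> {0..<T}. F x t = 0}"
      using \<open>0 < T\<close> by (intro cells_hit_le_count) auto
    finally show "(\<Sum>j<n. indicator (A n j) x) \<le> emeasure (count_space UNIV) {t \<in> {0..<T}. F x t = 0}" .
  qed
  then have "ennreal (T * \<sigma> / pi) \<le> (\<integral>\<^sup>+x. count_zeros T (F x) \<partial>?U)"
    by (intro LIMSEQ_le_const2[OF lim]) auto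
  with upper show ?thesis by (simp add: F_def)
qed

section \<open>The curve of derivatives of trigonometric polynomials\<close>

text \<open>
  With \<open>\<phi> = arccos (\<kappa> h)\<close> the quotient \<open>(\<phi> / h)\<^sup>2\<close> is the product of
  \<open>\<phi>\<^sup>2 / (2 (1 - cos \<phi>))\<close>, which tends to \<open>1\<close>, and of the quotient in the assumption.
\<close>
lemma arccos_small_angle:
  fixes \<kappa> :: "real \<Rightarrow> real"
  assumes curv: "((\<lambda>h. 2 * (1 - \<kappa> h) / h\<^sup>2) \<longlongrightarrow> \<rho>) (at_right 0)" and "0 < \<rho>"
    and le: "\<And>h. \<bar>\<kappa> h\<bar> \<le> 1"
  shows "((\<lambda>h. arccos (\<kappa> h) / h) \<longlongrightarrow> sqrt \<rho>) (at_right 0)"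
proof -
  have h2: "((\<lambda>h::real. h\<^sup>2 / 2) \<longlongrightarrow> 0) (at_right 0)" by real_asymp
  have pos: "\<forall>\<^sub>F h in at_right (0::real). 0 < h" by (simp add: eventually_at_right_less)
  have "((\<lambda>h. 1 - 2 * (1 - \<kappa> h) / h\<^sup>2 * (h\<^sup>2 / 2)) \<longlongrightarrow> 1 - \<rho> * 0) (at_right 0)"
    by (intro tendsto_diff tendsto_const tendsto_mult curv h2)
  moreover have "\<forall>\<^sub>F h in at_right 0. 1 - 2 * (1 - \<kappa> h) / h\<^sup>2 * (h\<^sup>2 / 2) = \<kappa> h"
    using pos by eventually_elim (auto simp: field_simps)
  ultimately have "(\<kappa> \<longlongrightarrow> 1 - \<rho> * 0) (at_right 0)"
    by (rule Lim_transform_eventually)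
  then have lim\<kappa>: "(\<kappa> \<longlongrightarrow> 1) (at_right 0)" by simp
  have lt: "\<forall>\<^sub>F h in at_right 0. \<kappa> h < 1"
    using order_tendstoD(1)[OF curv \<open>0 < \<rho>\<close>] pos
    by eventually_elim (auto simp: zero_less_divide_iff)
  define \<phi> where "\<phi> = (\<lambda>h. arccos (\<kappa> h))"
  have "((\<lambda>h. arccos (\<kappa> h)) \<longlongrightarrow> arccos 1) (at_right 0)"
    by (rule continuous_on_tendsto_compose[OF continuous_on_arccos' lim\<kappa>])
       (use le in \<open>auto simp: abs_le_iff intro!: always_eventually\<close>)
  moreover have "\<forall>\<^sub>F h in at_right 0. 0 < \<phi> h"
    using lt by eventually_elim (use le in \<open>auto simp: \<phi>_def abs_le_iff arccos_less_arccos[of _ 1, simplified]\<close>)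
  ultimately have \<phi>: "filterlim \<phi> (at_right 0) (at_right 0)"
    by (auto simp: filterlim_at \<phi>_def elim: eventually_mono)
  \<comment> \<open>Composition needs \<open>\<phi> > 0\<close>, because this quotient has the value \<open>0\<close> at \<open>0\<close>.\<close>
  have "((\<lambda>x::real. x\<^sup>2 / (2 * (1 - cos x))) \<longlongrightarrow> 1) (at_right 0)" by real_asymp
  from filterlim_compose[OF this \<phi>] have "((\<lambda>h. (\<phi> h)\<^sup>2 / (2 * (1 - \<kappa> h))) \<longlongrightarrow> 1) (at_right 0)"
    using le by (simp add: \<phi>_def cos_arccos abs_le_iff)
  then have "((\<lambda>h. (\<phi> h)\<^sup>2 / (2 * (1 - \<kappa> h)) * (2 * (1 - \<kappa> h) / h\<^sup>2)) \<longlongrightarrow> 1 * \<rho>) (at_right 0)"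
    by (intro tendsto_mult curv)
  then have "((\<lambda>h. sqrt ((\<phi> h)\<^sup>2 / (2 * (1 - \<kappa> h)) * (2 * (1 - \<kappa> h) / h\<^sup>2))) \<longlongrightarrow> sqrt (1 * \<rho>)) (at_right 0)"
    by (intro tendsto_real_sqrt)
  moreover have "\<forall>\<^sub>F h in at_right 0. sqrt ((\<phi> h)\<^sup>2 / (2 * (1 - \<kappa> h)) * (2 * (1 - \<kappa> h) / h\<^sup>2)) = \<phi> h / h"
    using lt pos
  proof eventually_elim
    fix h assume h: "\<kappa> h < 1" "0 < h"
    have "0 \<le> \<phi> h" using le[of h] by (simp add: \<phi>_def abs_le_iff arccos_lbound)
    then show "sqrt ((\<phi> h)\<^sup>2 / (2 * (1 - \<kappa> h)) * (2 * (1 - \<kappa> h) / h\<^sup>2)) = \<phi> h / h"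
      using h by (simp add: real_sqrt_divide)
  qed
  ultimately show ?thesis
    by (simp add: \<phi>_def tendsto_cong)
qed

definition sum_pow :: "nat \<Rightarrow> nat \<Rightarrow> real" where
  "sum_pow p \<nu> = (\<Sum>m=1..\<nu>. real m ^ p)"

lemma sum_pow_2: "6 * sum_pow 2 \<nu> = real \<nu> * (real \<nu> + 1) * (2 * real \<nu> + 1)"
  unfolding sum_pow_def by (induction \<nu>) (auto simp: algebra_simps power2_eq_square)

lemma sum_pow_4:
  "30 * sum_pow 4 \<nu> = real \<nu> * (real \<nu> + 1) * (2 * real \<nu> + 1) * (3 * (real \<nu>)\<^sup>2 + 3 * real \<nu> - 1)"
  unfolding sum_pow_def by (induction \<nu>) (auto simp: algebra_simps power2_eq_square power4_eq_xxxx)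

lemma sum_pow_pos: "0 < \<nu> \<Longrightarrow> 0 < sum_pow p \<nu>"
  unfolding sum_pow_def by (intro sum_pos) auto

lemma sum_pow_ratio:
  assumes "0 < \<nu>"
  shows "sum_pow 4 \<nu> / sum_pow 2 \<nu> = (3 * (real \<nu>)\<^sup>2 + 3 * real \<nu> - 1) / 5"
proof -
  have "30 * sum_pow 4 \<nu> = 6 * sum_pow 2 \<nu> * (3 * (real \<nu>)\<^sup>2 + 3 * real \<nu> - 1)"
    unfolding sum_pow_2 sum_pow_4 ..
  then show ?thesis using sum_pow_pos[OF assms, of 2] by (simp add: field_simps)
qed

text \<open>
  The vector that represents, in the coordinates of \<^const>\<open>trig_comb\<close>, the functional \<open>v \<mapsto> v' t\<close>,
  scaled to length one if \<open>\<nu> > 0\<close>. Thus \<open>t\<close> is a critical point of \<open>v\<close> iff the coordinate vector of \<open>v\<close> is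
  orthogonal to it.
\<close>
definition deriv_curve :: "nat \<Rightarrow> real \<Rightarrow> nat \<Rightarrow> real" where
  "deriv_curve \<nu> t k = (if k < \<nu> then - real (k + 1) * sin (real (k + 1) * t)
     else real (k - \<nu> + 1) * cos (real (k - \<nu> + 1) * t)) / sqrt (sum_pow 2 \<nu>)"

definition deriv_curve' :: "nat \<Rightarrow> real \<Rightarrow> nat \<Rightarrow> real" where
  "deriv_curve' \<nu> t k = (if k < \<nu> then - (real (k + 1) ^ 2) * cos (real (k + 1) * t)
     else - (real (k - \<nu> + 1) ^ 2) * sin (real (k - \<nu> + 1) * t)) / sqrt (sum_pow 2 \<nu>)"

definition deriv_curve'' :: "nat \<Rightarrow> real \<Rightarrow> nat \<Rightarrow> real" where
  "deriv_curve'' \<nu> t k = (if k < \<nu> then real (k + 1) ^ 3 * sin (real (k + 1) * t)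
     else - (real (k - \<nu> + 1) ^ 3) * cos (real (k - \<nu> + 1) * t)) / sqrt (sum_pow 2 \<nu>)"

lemma DERIV_deriv_curve:
  "((\<lambda>t. deriv_curve \<nu> t k) has_real_derivative deriv_curve' \<nu> t k) (at t)"
  unfolding deriv_curve_def deriv_curve'_def
  by (rule DERIV_cdivide, cases "k < \<nu>") (auto intro!: derivative_eq_intros simp: power2_eq_square algebra_simps)

lemma DERIV_deriv_curve':
  "((\<lambda>t. deriv_curve' \<nu> t k) has_real_derivative deriv_curve'' \<nu> t k) (at t)"
  unfolding deriv_curve'_def deriv_curve''_def
  by (rule DERIV_cdivide, cases "k < \<nu>") (auto intro!: derivative_eq_intros simp: power2_eq_square power3_eq_cube)

text \<open>
  The cosine and the sine of the same frequency combine through the addition theorem, so the inner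
  product depends on \<open>t - s\<close> only.
\<close>
lemma dot_deriv_curve:
  "dot {..<2 * \<nu>} (deriv_curve \<nu> s) (deriv_curve \<nu> t)
    = (\<Sum>m=1..\<nu>. real m ^ 2 * cos (real m * (t - s))) / sum_pow 2 \<nu>"
proof -
  have nn: "0 \<le> sum_pow 2 \<nu>" by (simp add: sum_pow_def sum_nonneg)
  have "dot {..<2 * \<nu>} (deriv_curve \<nu> s) (deriv_curve \<nu> t) = (\<Sum>m=1..\<nu>. real m ^ 2 * cos (real m * (t - s)) / sum_pow 2 \<nu>)"
    unfolding dot_def sum_split_double
  proof (rule sum.cong)
    fix m assume "m \<in> {1..\<nu>}"
    then have m: "m - 1 < \<nu>" "m - 1 + 1 = m" "\<not> \<nu> + m - 1 < \<nu>" "\<nu> + m - 1 - \<nu> + 1 = m" by auto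
    have "cos (real m * (t - s)) = cos (real m * s) * cos (real m * t) + sin (real m * s) * sin (real m * t)"
      by (simp add: right_diff_distrib cos_diff mult.commute)
    then show "deriv_curve \<nu> s (m - 1) * deriv_curve \<nu> t (m - 1) + deriv_curve \<nu> s (\<nu> + m - 1) * deriv_curve \<nu> t (\<nu> + m - 1)
      = real m ^ 2 * cos (real m * (t - s)) / sum_pow 2 \<nu>"
      unfolding deriv_curve_def using nn
      by (simp only: m if_True if_False) (simp add: power2_eq_square add_divide_distrib distrib_left mult_ac)
  qed simp
  then show ?thesis by (simp add: sum_divide_distrib)
qed

lemma L2_set_deriv_curve'':
  "L2_set (deriv_curve'' \<nu> t) {..<2 * \<nu>} = sqrt (sum_pow 6 \<nu> / sum_pow 2 \<nu>)"
proof -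
  have nn: "0 \<le> sum_pow 2 \<nu>" by (simp add: sum_pow_def sum_nonneg)
  have "dot {..<2 * \<nu>} (deriv_curve'' \<nu> t) (deriv_curve'' \<nu> t) = (\<Sum>m=1..\<nu>. real m ^ 6 / sum_pow 2 \<nu>)"
    unfolding dot_def sum_split_double
  proof (rule sum.cong)
    fix m assume "m \<in> {1..\<nu>}"
    then have m: "m - 1 < \<nu>" "m - 1 + 1 = m" "\<not> \<nu> + m - 1 < \<nu>" "\<nu> + m - 1 - \<nu> + 1 = m" by auto
    have "deriv_curve'' \<nu> t (m - 1) * deriv_curve'' \<nu> t (m - 1) + deriv_curve'' \<nu> t (\<nu> + m - 1) * deriv_curve'' \<nu> t (\<nu> + m - 1)
      = real m ^ 6 * ((sin (real m * t))\<^sup>2 + (cos (real m * t))\<^sup>2) / sum_pow 2 \<nu>"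
      unfolding deriv_curve''_def using nn
      by (simp only: m if_True if_False)
         (simp add: power2_eq_square add_divide_distrib distrib_left mult_ac eval_nat_numeral)
    then show "deriv_curve'' \<nu> t (m - 1) * deriv_curve'' \<nu> t (m - 1) + deriv_curve'' \<nu> t (\<nu> + m - 1) * deriv_curve'' \<nu> t (\<nu> + m - 1)
      = real m ^ 6 / sum_pow 2 \<nu>" by simp
  qed simp
  then show ?thesis by (simp add: L2_set_dot sum_pow_def sum_divide_distrib)
qed

text \<open>
  The second-order expansion of \<open>cos (m h)\<close> gives the angular speed: its square is the mean of
  \<open>m\<^sup>2\<close> with weights proportional to \<open>m\<^sup>2\<close>.
\<close>
lemma expected_zeros_derivative:
  assumes "0 < \<nu>"
  shows "(\<integral>\<^sup>+x. count_zeros (2 * pi) (\<lambda>t. dot {..<2 * \<nu>} x (deriv_curve \<nu> t)) \<partial>uniform_ball {..<2 * \<nu>})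
    = ennreal (2 * sqrt (sum_pow 4 \<nu> / sum_pow 2 \<nu>))"
proof -
  define \<kappa> where "\<kappa> = (\<lambda>h. (\<Sum>m=1..\<nu>. real m ^ 2 * cos (real m * h)) / sum_pow 2 \<nu>)"
  have pos: "0 < sum_pow p \<nu>" for p using sum_pow_pos[OF assms] .
  have \<kappa>0: "\<kappa> 0 = 1" using pos[of 2] by (simp add: \<kappa>_def sum_pow_def)
  have stat: "dot {..<2 * \<nu>} (deriv_curve \<nu> s) (deriv_curve \<nu> t) = \<kappa> (t - s)" for s t
    unfolding \<kappa>_def by (rule dot_deriv_curve)
  have le: "\<bar>\<kappa> h\<bar> \<le> 1" for h
    using dot_le_norms[of "{..<2 * \<nu>}" "deriv_curve \<nu> 0" "deriv_curve \<nu> h"]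
    by (simp add: stat L2_set_dot \<kappa>0)
  have "((\<lambda>h. 2 * (1 - cos (real m * h)) / h\<^sup>2) \<longlongrightarrow> (real m)\<^sup>2) (at_right 0)" if "m > 0" for m :: nat
    using that by (real_asymp simp: power2_eq_square)
  then have "((\<lambda>h. (\<Sum>m=1..\<nu>. real m ^ 2 * (2 * (1 - cos (real m * h)) / h\<^sup>2)) / sum_pow 2 \<nu>)
      \<longlongrightarrow> (\<Sum>m=1..\<nu>. real m ^ 2 * (real m)\<^sup>2) / sum_pow 2 \<nu>) (at_right 0)"
    using pos[of 2] by (intro tendsto_intros tendsto_sum) auto
  moreover have "(\<Sum>m=1..\<nu>. real m ^ 2 * (2 * (1 - cos (real m * h)) / h\<^sup>2)) / sum_pow 2 \<nu> = 2 * (1 - \<kappa> h) / h\<^sup>2" for h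
  proof -
    have "(\<Sum>m=1..\<nu>. real m ^ 2 * (2 * (1 - cos (real m * h)) / h\<^sup>2))
      = 2 / h\<^sup>2 * (sum_pow 2 \<nu> - (\<Sum>m=1..\<nu>. real m ^ 2 * cos (real m * h)))"
      by (simp add: sum_pow_def sum_distrib_left right_diff_distrib sum_subtractf diff_divide_distrib mult_ac)
    then show ?thesis using pos[of 2] by (simp add: \<kappa>_def field_simps)
  qed
  moreover have "(\<Sum>m=1..\<nu>. real m ^ 2 * (real m)\<^sup>2) = sum_pow 4 \<nu>"
    by (simp add: sum_pow_def flip: power_add)
  ultimately have "((\<lambda>h. 2 * (1 - \<kappa> h) / h\<^sup>2) \<longlongrightarrow> sum_pow 4 \<nu> / sum_pow 2 \<nu>) (at_right 0)" by simp
  then have "((\<lambda>h. arccos (\<kappa> h) / h) \<longlongrightarrow> sqrt (sum_pow 4 \<nu> / sum_pow 2 \<nu>)) (at_right 0)"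
    using pos le by (intro arccos_small_angle) auto
  from expected_count_zeros[OF _ _ DERIV_deriv_curve DERIV_deriv_curve' _ stat \<kappa>0 this,
      of "sqrt (sum_pow 6 \<nu> / sum_pow 2 \<nu>)" "2 * pi"]
  show ?thesis using assms by (simp add: L2_set_deriv_curve'')
qed

section \<open>Means over the sphere of trigonometric polynomials\<close>

text \<open>
  A measurable inverse of \<^const>\<open>trig_comb\<close>. It carries measurability on the coordinate space over
  to the Borel sets of the function space.
\<close>
definition trig_coords :: "nat \<Rightarrow> (real \<Rightarrow> real) \<Rightarrow> nat \<Rightarrow> real" where
  "trig_coords \<nu> v = (\<lambda>k\<in>{..<2 * \<nu>}. L2_inner v (trig_basis \<nu> k))"

lemma L2_inner_trig_basis:
  assumes "k < 2 * \<nu>"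
  shows "L2_inner (trig_comb \<nu> x) (trig_basis \<nu> k) = x k"
proof -
  have "trig_basis \<nu> k = trig_comb \<nu> (\<lambda>j. if j = k then 1 else 0)"
    using assms by (simp add: trig_comb_def fun_eq_iff if_distrib[of "\<lambda>a. a * _"] cong: if_cong)
  then show ?thesis
    using assms by (simp add: L2_inner_trig_comb if_distrib[of "(*) _"] cong: if_cong)
qed

lemma trig_comb_coords:
  assumes "v \<in> trig_space \<nu>"
  shows "trig_comb \<nu> (trig_coords \<nu> v) = v"
proof -
  obtain x where v: "v = trig_comb \<nu> x" using assms by (auto simp: trig_space_eq_range)
  have "trig_coords \<nu> v k = x k" if "k < 2 * \<nu>" for k
    using that by (simp add: v trig_coords_def L2_inner_trig_basis)
  then show ?thesis unfolding v by (simp add: trig_comb_def)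
qed

lemma measurable_trig_coords:
  "trig_coords \<nu> \<in> measurable (trig_borel \<nu>) (lebesgue_on_coords {..<2 * \<nu>})"
  unfolding trig_coords_def
proof (rule measurable_restrict)
  fix k assume "k \<in> {..<2 * \<nu>}"
  then have k: "k < 2 * \<nu>" by simp
  have "(\<lambda>v. L2_inner v (trig_basis \<nu> k)) \<in> borel_measurable (trig_borel \<nu>)"
  proof (rule borel_measurableI)
    fix S :: "real set" assume S: "open S"
    let ?W = "(\<lambda>v. L2_inner v (trig_basis \<nu> k)) -` S \<inter> space (trig_borel \<nu>)"
    show "?W \<in> sets (trig_borel \<nu>)"
    proof (rule sets_trig_borel_open)
      fix u assume u: "u \<in> ?W"
      then obtain r where r: "r > 0" "\<And>t. \<bar>t - L2_inner u (trig_basis \<nu> k)\<bar> < r \<Longrightarrow> t \<in> S"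
        using S by (auto simp: open_real)
      have "v \<in> ?W" if v: "v \<in> trig_space \<nu>" "L2_dist u v < r" for v
      proof -
        obtain x y where [simp]: "u = trig_comb \<nu> x" "v = trig_comb \<nu> y"
          using u v by (auto simp: trig_space_eq_range)
        have "\<bar>x k - y k\<bar> \<le> L2_set (\<lambda>k. \<bar>x k - y k\<bar>) {..<2 * \<nu>}"
          using k by (intro member_le_L2_set) auto
        also have "\<dots> = L2_dist u v" by (simp add: L2_dist_trig_comb L2_set_def)
        finally have "\<bar>y k - x k\<bar> < r" using v(2) by (simp add: abs_minus_commute)
        then show ?thesis using r(2) v(1) k by (simp add: L2_inner_trig_basis)
      qed
      then show "\<exists>r>0. \<forall>v\<in>trig_space \<nu>. L2_dist u v < r \<longrightarrow> v \<in> ?W" using r(1) by blast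
    qed auto
  qed
  then show "(\<lambda>v. L2_inner v (trig_basis \<nu> k)) \<in> measurable (trig_borel \<nu>) lborel" by simp
qed

lemma L2_norm_trig_comb_dot: "L2_norm (trig_comb \<nu> x) = sqrt (dot {..<2 * \<nu>} x x)"
  by (simp add: L2_norm_trig_comb L2_set_dot)

text \<open>
  The area of the sphere is defined by radial projection of the volume on the punctured ball. A
  function that is constant along rays therefore has the same mean on the sphere and on the ball.
\<close>
lemma nn_integral_sphere_area:
  assumes "0 < \<nu>" and F: "F \<in> borel_measurable (trig_borel \<nu>)"
    and homogeneous: "\<And>v. v \<in> trig_space \<nu> \<Longrightarrow> 0 < L2_norm v \<Longrightarrow> F (\<lambda>\<theta>. v \<theta> / L2_norm v) = F v"
  shows "(\<integral>\<^sup>+v. F v \<partial>sphere_area \<nu>)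
    = emeasure (sphere_area \<nu>) (trig_sphere \<nu>) * (\<integral>\<^sup>+x. F (trig_comb \<nu> x) \<partial>uniform_ball {..<2 * \<nu>})"
proof -
  let ?I = "{..<2 * \<nu>}"
  let ?P = "lebesgue_on_coords ?I" and ?B = "punctured_unit_ball ?I"
  have I: "finite ?I" "?I \<noteq> {}" using assms by (auto simp: lessThan_empty_iff)
  interpret prob_space "uniform_ball ?I" using I by (rule prob_space_uniform_ball)
  note B = emeasure_punctured_unit_ball[OF I]
  have eq: "(\<integral>\<^sup>+v. F v \<partial>sphere_area \<nu>)
      = ennreal (real (2 * \<nu>)) * emeasure ?P ?B * (\<integral>\<^sup>+x. F (trig_comb \<nu> x) \<partial>uniform_ball ?I)"
    if F: "F \<in> borel_measurable (trig_borel \<nu>)"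
    and hom: "\<And>v. v \<in> trig_space \<nu> \<Longrightarrow> 0 < L2_norm v \<Longrightarrow> F (\<lambda>\<theta>. v \<theta> / L2_norm v) = F v"
    for F :: "(real \<Rightarrow> real) \<Rightarrow> ennreal"
  proof -
    have FP: "(\<lambda>x. F (trig_comb \<nu> x)) \<in> borel_measurable ?P"
      using measurable_compose[OF measurable_trig_comb F] .
    have ball: "punctured_ball \<inter> space (trig_volume \<nu>) \<in> sets (trig_volume \<nu>)"
      using sets_punctured_ball[of \<nu>] by (simp add: trig_volume_def)
    have ind: "(\<lambda>v. F v * indicator (punctured_ball \<inter> trig_space \<nu>) v) \<in> borel_measurable (trig_borel \<nu>)"
      using F sets_punctured_ball[of \<nu>] by (intro borel_measurable_times_ennreal borel_measurable_indicator)
    have "(\<integral>\<^sup>+v. F v \<partial>sphere_area \<nu>) = ennreal (real (2 * \<nu>)) *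
        (\<integral>\<^sup>+v. F (\<lambda>\<theta>. v \<theta> / L2_norm v) \<partial>restrict_space (trig_volume \<nu>) punctured_ball)"
      unfolding sphere_area_def using F
      by (simp add: nn_integral_scale_measure nn_integral_distr[OF measurable_normalize] measurable_restrict_space1)
    also have "(\<integral>\<^sup>+v. F (\<lambda>\<theta>. v \<theta> / L2_norm v) \<partial>restrict_space (trig_volume \<nu>) punctured_ball)
      = (\<integral>\<^sup>+v. F (\<lambda>\<theta>. v \<theta> / L2_norm v) * indicator punctured_ball v \<partial>trig_volume \<nu>)"
      using ball by (rule nn_integral_restrict_space)
    also have "\<dots> = (\<integral>\<^sup>+v. F v * indicator (punctured_ball \<inter> trig_space \<nu>) v \<partial>trig_volume \<nu>)"
      by (intro nn_integral_cong) (auto simp: trig_volume_def hom split: split_indicator)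
    also have "\<dots> = (\<integral>\<^sup>+x. F (trig_comb \<nu> x) * indicator (punctured_ball \<inter> trig_space \<nu>) (trig_comb \<nu> x) \<partial>?P)"
      unfolding trig_volume_def using ind by (intro nn_integral_distr measurable_trig_comb) simp
    also have "\<dots> = (\<integral>\<^sup>+x. F (trig_comb \<nu> x) * indicator ?B x \<partial>?P)"
      by (intro nn_integral_cong)
        (auto simp: punctured_unit_ball_def L2_norm_trig_comb_dot trig_comb_in dot_self_nonneg split: split_indicator)
    also have "\<dots> = emeasure ?P ?B * (\<integral>\<^sup>+x. F (trig_comb \<nu> x) \<partial>uniform_ball ?I)"
      unfolding uniform_ball_def nn_integral_uniform_measure[OF FP sets_punctured_unit_ball] using B
      by (subst ennreal_times_divide, subst mult.commute, intro ennreal_mult_divide_eq[symmetric]) auto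
    finally show ?thesis by (simp add: mult.assoc)
  qed
  have "emeasure (sphere_area \<nu>) (trig_sphere \<nu>) = (\<integral>\<^sup>+v. 1 \<partial>sphere_area \<nu>)" by simp
  also have "\<dots> = ennreal (real (2 * \<nu>)) * emeasure ?P ?B"
    using eq[of "\<lambda>_. 1"] emeasure_space_1 by simp
  finally have area: "emeasure (sphere_area \<nu>) (trig_sphere \<nu>) = ennreal (real (2 * \<nu>)) * emeasure ?P ?B" .
  show ?thesis unfolding area by (rule eq[of F]) (fact F, rule homogeneous)
qed

lemma has_derivative_trig_comb:
  assumes "0 < \<nu>"
  shows "(trig_comb \<nu> x has_real_derivative sqrt (sum_pow 2 \<nu> / pi) * dot {..<2 * \<nu>} x (deriv_curve \<nu> t)) (at t)"
proof -
  have pos: "0 < sum_pow 2 \<nu>" by (rule sum_pow_pos[OF assms])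
  have basis: "(trig_basis \<nu> k has_real_derivative sqrt (sum_pow 2 \<nu> / pi) * deriv_curve \<nu> t k) (at t)" for k
  proof -
    have "((\<lambda>\<theta>. (if k < \<nu> then cos (real (k + 1) * \<theta>) else sin (real (k - \<nu> + 1) * \<theta>)) / sqrt pi)
      has_real_derivative (if k < \<nu> then - real (k + 1) * sin (real (k + 1) * t)
        else real (k - \<nu> + 1) * cos (real (k - \<nu> + 1) * t)) / sqrt pi) (at t)"
      by (rule DERIV_cdivide, cases "k < \<nu>") (auto intro!: derivative_eq_intros simp: algebra_simps)
    moreover have "sqrt (sum_pow 2 \<nu> / pi) * deriv_curve \<nu> t k = (if k < \<nu> then - real (k + 1) * sin (real (k + 1) * t)
        else real (k - \<nu> + 1) * cos (real (k - \<nu> + 1) * t)) / sqrt pi"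
      using pos by (simp add: deriv_curve_def real_sqrt_divide)
    moreover have "trig_basis \<nu> k = (\<lambda>\<theta>. (if k < \<nu> then cos (real (k + 1) * \<theta>)
        else sin (real (k - \<nu> + 1) * \<theta>)) / sqrt pi)"
      by (rule ext) (rule trig_basis_def)
    ultimately show ?thesis by (simp only:)
  qed
  have "(trig_comb \<nu> x has_real_derivative (\<Sum>k<2 * \<nu>. x k * (sqrt (sum_pow 2 \<nu> / pi) * deriv_curve \<nu> t k))) (at t)"
    unfolding trig_comb_def by (intro DERIV_sum DERIV_cmult basis)
  then show ?thesis by (simp add: dot_def sum_distrib_left mult_ac)
qed

lemma critical_points_trig_comb:
  assumes "0 < \<nu>"
  shows "critical_points (trig_comb \<nu> x) = {t \<in> {0..<2 * pi}. dot {..<2 * \<nu>} x (deriv_curve \<nu> t) = 0}"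
proof -
  have "(trig_comb \<nu> x has_real_derivative 0) (at t) \<longleftrightarrow> dot {..<2 * \<nu>} x (deriv_curve \<nu> t) = 0" for t
    using has_derivative_trig_comb[OF assms, of x t] sum_pow_pos[OF assms, of 2]
    by (auto dest: DERIV_unique)
  then show ?thesis by (simp add: critical_points_def)
qed

lemma critical_points_divide:
  assumes "a \<noteq> 0"
  shows "critical_points (\<lambda>\<theta>. v \<theta> / a) = critical_points v"
proof -
  have "((\<lambda>\<theta>. v \<theta> / a) has_real_derivative 0) (at t) \<longleftrightarrow> (v has_real_derivative 0) (at t)" for t
    using DERIV_cdivide[of v 0 t UNIV a] DERIV_cmult[of "\<lambda>\<theta>. v \<theta> / a" 0 t UNIV a] assms by auto
  then show ?thesis by (simp add: critical_points_def)
qed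

definition count_critical :: "(real \<Rightarrow> real) \<Rightarrow> ennreal" where
  "count_critical v = emeasure (count_space UNIV) (critical_points v)"

lemma count_critical_trig_comb:
  "0 < \<nu> \<Longrightarrow> count_critical (trig_comb \<nu> x) = count_zeros (2 * pi) (\<lambda>t. dot {..<2 * \<nu>} x (deriv_curve \<nu> t))"
  by (simp add: count_critical_def count_zeros_def critical_points_trig_comb)

lemma borel_measurable_count_critical:
  assumes "0 < \<nu>"
  shows "count_critical \<in> borel_measurable (trig_borel \<nu>)"
proof -
  have "(\<lambda>x. count_zeros (2 * pi) (\<lambda>t. dot {..<2 * \<nu>} x (deriv_curve \<nu> t)))
      \<in> borel_measurable (lebesgue_on_coords {..<2 * \<nu>})"
    by (intro borel_measurable_count_zeros borel_measurable_dot continuous_on_dot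
      continuous_at_imp_continuous_on ballI DERIV_isCont[OF DERIV_deriv_curve]) simp
  from measurable_compose[OF measurable_trig_coords this]
  have "(\<lambda>v. count_critical (trig_comb \<nu> (trig_coords \<nu> v))) \<in> borel_measurable (trig_borel \<nu>)"
    by (simp add: count_critical_trig_comb[OF assms])
  then show ?thesis
    by (subst measurable_cong[of _ count_critical "\<lambda>v. count_critical (trig_comb \<nu> (trig_coords \<nu> v))"])
      (simp_all add: trig_comb_coords)
qed

text \<open>
  Since the expected count is finite, polynomials with infinitely many critical points form a null
  set, so that the count in the extended reals agrees with the cardinality almost everywhere.
\<close>
theorem mean_crit_formula:
  assumes "0 < \<nu>"
  shows "mean_crit \<nu> = 2 * sqrt ((3 * (real \<nu>)\<^sup>2 + 3 * real \<nu> - 1) / 5)"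
proof -
  define M where "M = 2 * sqrt ((3 * (real \<nu>)\<^sup>2 + 3 * real \<nu> - 1) / 5)"
  let ?S = "sphere_area \<nu>"
  define a where "a = measure ?S (trig_sphere \<nu>)"
  have a: "emeasure ?S (trig_sphere \<nu>) = ennreal a" "0 < a"
    using sphere_area_positive_finite[OF assms] by (auto simp: a_def measure_def enn2real_positive_iff)
  have "0 \<le> sum_pow 4 \<nu> / sum_pow 2 \<nu>" by (simp add: sum_pow_def sum_nonneg)
  then have "0 \<le> M" unfolding M_def sum_pow_ratio[OF assms, symmetric] by simp
  have "(\<integral>\<^sup>+v. count_critical v \<partial>?S)
      = ennreal a * (\<integral>\<^sup>+x. count_critical (trig_comb \<nu> x) \<partial>uniform_ball {..<2 * \<nu>})"
    unfolding a(1)[symmetric]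
    by (rule nn_integral_sphere_area[OF assms borel_measurable_count_critical[OF assms]])
      (simp add: count_critical_def critical_points_divide)
  also have "\<dots> = ennreal (a * M)"
    using a(2) \<open>0 \<le> M\<close>
    by (simp add: count_critical_trig_comb assms expected_zeros_derivative sum_pow_ratio M_def ennreal_mult')
  finally have int: "(\<integral>\<^sup>+v. count_critical v \<partial>?S) = ennreal (a * M)" .
  have meas [measurable]: "count_critical \<in> borel_measurable ?S"
  proof -
    have "sets ?S = sets (restrict_space (trig_borel \<nu>) (trig_sphere \<nu>))" by (simp add: sphere_area_def)
    then show ?thesis
      using measurable_restrict_space1[OF borel_measurable_count_critical[OF assms]]
      by (simp cong: measurable_cong_sets)
  qed
  have card: "real (card (critical_points v)) = enn2real (count_critical v)" for v
    by (cases "finite (critical_points v)") (auto simp: count_critical_def)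
  have "AE v in ?S. count_critical v \<noteq> \<infinity>"
    using meas by (rule nn_integral_PInf_AE) (simp add: int)
  then have "(\<integral>\<^sup>+v. ennreal (enn2real (count_critical v)) \<partial>?S) = (\<integral>\<^sup>+v. count_critical v \<partial>?S)"
    by (intro nn_integral_cong_AE) (auto simp: less_top elim: eventually_mono)
  then have "(\<integral>v. real (card (critical_points v)) \<partial>?S) = a * M"
    unfolding card using a(2) \<open>0 \<le> M\<close> by (subst integral_eq_nn_integral) (auto simp: int)
  then show ?thesis using a(2) by (simp add: mean_crit_def a_def[symmetric] M_def)
qed

section \<open>Asymptotics\<close>

theorem corollary3p3:
  shows "mean_crit \<sim>[sequentially] (\<lambda>\<nu>. 2 * sqrt (3 / 5) * real \<nu>)"
proof (rule asymp_equivI')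
  have "(\<lambda>\<nu>. sqrt ((real \<nu>)\<^sup>2 + real \<nu> - 1 / 3) / real \<nu>) \<longlonglongrightarrow> 1" by real_asymp
  moreover have "\<forall>\<^sub>F \<nu> in sequentially. sqrt ((real \<nu>)\<^sup>2 + real \<nu> - 1 / 3) / real \<nu>
      = mean_crit \<nu> / (2 * sqrt (3 / 5) * real \<nu>)"
    using eventually_gt_at_top[of 0]
  proof eventually_elim
    fix \<nu> :: nat assume "0 < \<nu>"
    have "(3 * (real \<nu>)\<^sup>2 + 3 * real \<nu> - 1) / 5 = 3 / 5 * ((real \<nu>)\<^sup>2 + real \<nu> - 1 / 3)"
      by (simp add: field_simps)
    then have "mean_crit \<nu> = 2 * (sqrt (3 / 5) * sqrt ((real \<nu>)\<^sup>2 + real \<nu> - 1 / 3))"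
      unfolding mean_crit_formula[OF \<open>0 < \<nu>\<close>] by (simp only: real_sqrt_mult)
    then show "sqrt ((real \<nu>)\<^sup>2 + real \<nu> - 1 / 3) / real \<nu> = mean_crit \<nu> / (2 * sqrt (3 / 5) * real \<nu>)"
      by simp
  qed
  ultimately show "(\<lambda>\<nu>. mean_crit \<nu> / (2 * sqrt (3 / 5) * real \<nu>)) \<longlonglongrightarrow> 1"
    by (rule Lim_transform_eventually)
qed

end
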